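(* Let $\mathbf J_e\in L_2(0,T;\mathbf L_{2,\varepsilon_0^{-1}(1+\chi^{(1)})^{-1}}(\Omega))$ and $\mathbf J_m\in L_2(0,T;\mathbf L_{2,\mu_0^{-1}}(\Omega))$ (the electric and magnetic current densities) be given, and assume that the system $$(\varepsilon(\mathbf E)\partial_t\mathbf E,\Psi)-(\nabla\times\mathbf H,\Psi)=-(\mathbf J_e,\Psi)\quad\forall\,\Psi\in\mathbf L_2(\Omega),$$ $$(\mu_0\partial_t\mathbf H,\Phi)+(\mathbf E,\nabla\times\Phi)=-(\mathbf J_m,\Phi)\quad\forall\,\Phi\in\mathbf H(\mathrm{curl},\Omega),$$ on $(0,T)$, together with the initial conditions $\mathbf E(0)=\mathbf E_0$, $\mathbf H(0)=\mathbf H_0$, has a weak solution $$(\mathbf E,\mathbf H)\in\big(C^1(0,T;\mathbf L_{2,\varepsilon(\mathbf E)}(\Omega))\cap C(0,T;\mathbf H_0(\mathrm{curl},\Omega))\big)\times\big(C^1(0,T;\mathbf L_2(\Omega))\cap C(0,T;\mathbf H(\mathrm{curl},\Omega))\big).$$ Let $$W(t):=\frac12\Big[\|\mathbf E(t)\|_{\varepsilon_0(1+\chi^{(1)})}^2+\frac32\big\||\mathbf E(t)|^2\big\|_{\varepsilon_0\chi^{(3)}}^2+\|\mathbf H(t)\|_{\mu_0}^2\Big]$$ denote the nonlinear electromagnetic energy at time $t$. Then $$\frac{dW}{dt}=-(\mathbf J_e,\mathbf E)-(\mathbf J_m,\mathbf H),\qquad t\in(0,T).$$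
   Context: $\Omega\subset\mathbb R^3$ is a simply connected domain with sufficiently smooth boundary $\partial\Omega$ and outward unit normal $\nu$; $T>0$; $\varepsilon_0,\mu_0>0$ are constants. The susceptibility coefficients $\chi^{(1)},\chi^{(3)}:\Omega\to\mathbb R$ are measurable with $\chi^{(1)},\chi^{(3)}\ge0$ a.e. in $\Omega$. For a vector (field) $\mathbf E$, $$\varepsilon(\mathbf E):=\varepsilon_0\big((1+\chi^{(1)}+\chi^{(3)}|\mathbf E|^2)\mathbf I+2\chi^{(3)}\mathbf E\mathbf E^\top\big),$$ with $\mathbf I$ the $3\times3$ identity matrix. The initial data are given fields $\mathbf E_0,\mathbf H_0:\Omega\to\mathbb R^3$, where $\mathbf H_0$ satisfies $\nabla\cdot(\mu_0\mathbf H_0)=0$ in $\Omega$ and $\mathbf H_0\cdot\nu=0$ on $\partial\Omega$. $\mathbf L_2(\Omega)=[L^2(\Omega)]^3$ and $(\mathbf u,\mathbf v)=\int_\Omega\mathbf u\cdot\mathbf v\,d\mathbf x$. For a scalar weight $\omega$, $\|\mathbf u\|_\omega^2=\int_\Omega\omega|\mathbf u|^2d\mathbf x$ (in particular $\||\mathbf E|^2\|_{\varepsilon_0\chi^{(3)}}^2=\int_\Omega\varepsilon_0\chi^{(3)}|\mathbf E|^4d\mathbf x$), and $\mathbf L_{2,\omega}(\Omega)$ is the space of measurable fields with finite norm. For the matrix weight $\varepsilon(\mathbf E)$, the norm is $\|\mathbf u\|_{\varepsilon(\mathbf E)}^2=\int_\Omega\mathbf u^\top\varepsilon(\mathbf E)\mathbf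 u\,d\mathbf x$; since this weight depends on $t$ through $\mathbf E(t)$, $\mathbf u\in C^1(0,T;\mathbf L_{2,\varepsilon(\mathbf E)}(\Omega))$ is understood as: $\mathbf u\in C^1(0,T;\mathbf L_2(\Omega))$ and, for $j=0,1$, the map $t\mapsto\varepsilon(\mathbf E(t))^{1/2}\mathbf u^{(j)}(t)$ is continuous and bounded from $(0,T)$ to $\mathbf L_2(\Omega)$. $\mathbf H(\mathrm{curl},\Omega)=\{\mathbf u\in\mathbf L_2(\Omega):\nabla\times\mathbf u\in\mathbf L_2(\Omega)\}$; $\mathbf H_0(\mathrm{curl},\Omega)=\{\mathbf u\in\mathbf H(\mathrm{curl},\Omega):\mathbf u\times\nu|_{\partial\Omega}=0\}$. $C^m(0,T;X)$ is the space of functions $(0,T)\to X$ with continuous derivatives up to order $m$, with norm $\sum_{j=0}^m\sup_{t\in(0,T)}\|\mathbf u^{(j)}(t)\|_X$, and $C=C^0$. $L_2(0,T;X)$ is the space of strongly measurable $\mathbf u:(0,T)\to X$ with $\int_0^T\|\mathbf u(t)\|_X^2dt<\infty$. The variational equations are required for all $t\in(0,T)$, and the initial conditions are understood in the sense of continuity in time with values in $\mathbf L_2(\Omega)$. *)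

theory Defs
  imports "HOL-Analysis.Analysis"
begin

(* Fields on Om are represented by total functions on real^3, whose values outside Om are irrelevant.
   Elements of the L2-type spaces are representatives, so norms below are seminorms and equality
   in a space means equality almost everywhere on Om. *)

fun Ck_on :: "nat \<Rightarrow> 'a::euclidean_space set \<Rightarrow> ('a \<Rightarrow> 'b::real_normed_vector) \<Rightarrow> bool" where
  "Ck_on 0 U f \<longleftrightarrow> continuous_on U f"
| "Ck_on (Suc k) U f \<longleftrightarrow> f differentiable_on U \<and>
     (\<forall>b\<in>Basis. Ck_on k U (\<lambda>x. frechet_derivative f (at x) b))"

definition test_functions :: "'a::euclidean_space set \<Rightarrow> ('a \<Rightarrow> 'b::real_normed_vector) set" where
  "test_functions U = {\<phi>. (\<forall>k. Ck_on k UNIV \<phi>) \<and> compact (closure {x. \<phi> x \<noteq> 0}) \<and>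
     closure {x. \<phi> x \<noteq> 0} \<subseteq> U}"

definition partial_deriv :: "3 \<Rightarrow> (real^3 \<Rightarrow> real) \<Rightarrow> real^3 \<Rightarrow> real" where
  "partial_deriv i f x = frechet_derivative f (at x) (axis i 1)"

definition grad :: "(real^3 \<Rightarrow> real) \<Rightarrow> real^3 \<Rightarrow> real^3" where
  "grad f x = (\<chi> i. partial_deriv i f x)"

definition curl :: "(real^3 \<Rightarrow> real^3) \<Rightarrow> real^3 \<Rightarrow> real^3" where
  "curl u x = vector
     [partial_deriv 2 (\<lambda>y. u y $ 3) x - partial_deriv 3 (\<lambda>y. u y $ 2) x,
      partial_deriv 3 (\<lambda>y. u y $ 1) x - partial_deriv 1 (\<lambda>y. u y $ 3) x,
      partial_deriv 1 (\<lambda>y. u y $ 2) x - partial_deriv 2 (\<lambda>y. u y $ 1) x]"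

(* The outward unit normal at a boundary point in U is grad g / |grad g|.  C^1 is the weakest
   regularity for which it is defined and continuous; every smoother boundary is included.
   Om is not required to be bounded. *)
definition C1_boundary :: "(real^3) set \<Rightarrow> bool" where
  "C1_boundary Om \<longleftrightarrow> (\<forall>p\<in>frontier Om. \<exists>U g. open U \<and> p \<in> U \<and> Ck_on 1 U g \<and>
     (\<forall>x\<in>U. grad g x \<noteq> 0) \<and>
     Om \<inter> U = {x\<in>U. g x < 0} \<and> frontier Om \<inter> U = {x\<in>U. g x = 0})"

definition smooth_simply_connected_domain :: "(real^3) set \<Rightarrow> bool" where
  "smooth_simply_connected_domain Om \<longleftrightarrow>
     open Om \<and> connected Om \<and> Om \<noteq> {} \<and> simply_connected Om \<and> C1_boundary Om"

definition wnorm :: "(real^3) set \<Rightarrow> (real^3 \<Rightarrow> real) \<Rightarrow> (real^3 \<Rightarrow> 'b::euclidean_space) \<Rightarrow> real" where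
  "wnorm Om w u = sqrt (LINT x|lebesgue_on Om. w x * (norm (u x))\<^sup>2)"

definition L2w :: "(real^3) set \<Rightarrow> (real^3 \<Rightarrow> real) \<Rightarrow> (real^3 \<Rightarrow> 'b::euclidean_space) set" where
  "L2w Om w = {u. u \<in> borel_measurable (lebesgue_on Om) \<and>
     integrable (lebesgue_on Om) (\<lambda>x. w x * (norm (u x))\<^sup>2)}"

abbreviation L2 :: "(real^3) set \<Rightarrow> (real^3 \<Rightarrow> 'b::euclidean_space) set" where
  "L2 Om \<equiv> L2w Om (\<lambda>_. 1)"

abbreviation L2norm :: "(real^3) set \<Rightarrow> (real^3 \<Rightarrow> 'b::euclidean_space) \<Rightarrow> real" where
  "L2norm Om \<equiv> wnorm Om (\<lambda>_. 1)"

definition pairing :: "(real^3) set \<Rightarrow> (real^3 \<Rightarrow> 'b::euclidean_space) \<Rightarrow> (real^3 \<Rightarrow> 'b) \<Rightarrow> real" where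
  "pairing Om u v = (LINT x|lebesgue_on Om. u x \<bullet> v x)"

definition pairing_defined ::
  "(real^3) set \<Rightarrow> (real^3 \<Rightarrow> 'b::euclidean_space) \<Rightarrow> (real^3 \<Rightarrow> 'b) \<Rightarrow> bool" where
  "pairing_defined Om u v \<longleftrightarrow> integrable (lebesgue_on Om) (\<lambda>x. u x \<bullet> v x)"

definition has_weak_curl :: "(real^3) set \<Rightarrow> (real^3 \<Rightarrow> real^3) \<Rightarrow> (real^3 \<Rightarrow> real^3) \<Rightarrow> bool" where
  "has_weak_curl Om u w \<longleftrightarrow>
     (\<forall>\<phi>\<in>test_functions Om. pairing Om u (curl \<phi>) = pairing Om w \<phi>)"

definition weak_curl :: "(real^3) set \<Rightarrow> (real^3 \<Rightarrow> real^3) \<Rightarrow> real^3 \<Rightarrow> real^3" where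
  "weak_curl Om u = (SOME w. w \<in> L2 Om \<and> has_weak_curl Om u w)"

definition Hcurl :: "(real^3) set \<Rightarrow> (real^3 \<Rightarrow> real^3) set" where
  "Hcurl Om = {u \<in> L2 Om. \<exists>w\<in>L2 Om. has_weak_curl Om u w}"

definition Hcurl_norm :: "(real^3) set \<Rightarrow> (real^3 \<Rightarrow> real^3) \<Rightarrow> real" where
  "Hcurl_norm Om u = sqrt ((L2norm Om u)\<^sup>2 + (L2norm Om (weak_curl Om u))\<^sup>2)"

(* The trace of u x nu for u in H(curl) is the functional given by Green's formula
     <u x nu, phi> = int_Om u . curl phi - curl u . phi,
   which for u smooth up to the boundary equals the surface integral of (u x nu) . phi.
   Test fields are smooth on the closure of Om, i.e. not required to vanish on the boundary. *)
definition tangential_trace ::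
  "(real^3) set \<Rightarrow> (real^3 \<Rightarrow> real^3) \<Rightarrow> (real^3 \<Rightarrow> real^3) \<Rightarrow> real" where
  "tangential_trace Om u \<phi> = pairing Om u (curl \<phi>) - pairing Om (weak_curl Om u) \<phi>"

definition H0curl :: "(real^3) set \<Rightarrow> (real^3 \<Rightarrow> real^3) set" where
  "H0curl Om = {u \<in> Hcurl Om. \<forall>\<phi>\<in>test_functions UNIV. tangential_trace Om u \<phi> = 0}"

definition has_weak_div :: "(real^3) set \<Rightarrow> (real^3 \<Rightarrow> real^3) \<Rightarrow> (real^3 \<Rightarrow> real) \<Rightarrow> bool" where
  "has_weak_div Om v d \<longleftrightarrow>
     (\<forall>\<psi>\<in>test_functions Om. pairing Om v (grad \<psi>) = - pairing Om d \<psi>)"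

definition weak_div :: "(real^3) set \<Rightarrow> (real^3 \<Rightarrow> real^3) \<Rightarrow> real^3 \<Rightarrow> real" where
  "weak_div Om v = (SOME d. d \<in> L2 Om \<and> has_weak_div Om v d)"

(* Likewise v . nu for v in H(div):  <v . nu, psi> = int_Om v . grad psi + (div v) psi. *)
definition normal_trace ::
  "(real^3) set \<Rightarrow> (real^3 \<Rightarrow> real^3) \<Rightarrow> (real^3 \<Rightarrow> real) \<Rightarrow> real" where
  "normal_trace Om v \<psi> = pairing Om v (grad \<psi>) + pairing Om (weak_div Om v) \<psi>"

(* A function space is passed as a carrier X together with its (semi)norm N.  The suprema in the
   norm of C^m(0,T;X) are over an open interval, hence the explicit boundedness. *)
definition C0_time ::
  "real \<Rightarrow> (real^3 \<Rightarrow> 'b::euclidean_space) set \<Rightarrow> ((real^3 \<Rightarrow> 'b) \<Rightarrow> real) \<Rightarrow>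
   (real \<Rightarrow> real^3 \<Rightarrow> 'b) set" where
  "C0_time T X N = {u. (\<forall>t\<in>{0<..<T}. u t \<in> X \<and>
       ((\<lambda>s. N (\<lambda>x. u s x - u t x)) \<longlongrightarrow> 0) (at t)) \<and>
     bounded ((\<lambda>t. N (u t)) ` {0<..<T})}"

definition has_time_deriv ::
  "(real^3 \<Rightarrow> 'b::euclidean_space) set \<Rightarrow> ((real^3 \<Rightarrow> 'b) \<Rightarrow> real) \<Rightarrow>
   (real \<Rightarrow> real^3 \<Rightarrow> 'b) \<Rightarrow> (real^3 \<Rightarrow> 'b) \<Rightarrow> real \<Rightarrow> bool" where
  "has_time_deriv X N u v t \<longleftrightarrow> v \<in> X \<and>
     ((\<lambda>s. N (\<lambda>x. (u s x - u t x) /\<^sub>R (s - t) - v x)) \<longlongrightarrow> 0) (at t)"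

definition time_deriv ::
  "(real^3 \<Rightarrow> 'b::euclidean_space) set \<Rightarrow> ((real^3 \<Rightarrow> 'b) \<Rightarrow> real) \<Rightarrow>
   (real \<Rightarrow> real^3 \<Rightarrow> 'b) \<Rightarrow> real \<Rightarrow> real^3 \<Rightarrow> 'b" where
  "time_deriv X N u t = (SOME v. has_time_deriv X N u v t)"

definition C1_time ::
  "real \<Rightarrow> (real^3 \<Rightarrow> 'b::euclidean_space) set \<Rightarrow> ((real^3 \<Rightarrow> 'b) \<Rightarrow> real) \<Rightarrow>
   (real \<Rightarrow> real^3 \<Rightarrow> 'b) set" where
  "C1_time T X N = {u \<in> C0_time T X N.
     (\<forall>t\<in>{0<..<T}. \<exists>v. has_time_deriv X N u v t) \<and> time_deriv X N u \<in> C0_time T X N}"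

abbreviation dt :: "(real^3) set \<Rightarrow> (real \<Rightarrow> real^3 \<Rightarrow> real^3) \<Rightarrow> real \<Rightarrow> real^3 \<Rightarrow> real^3" where
  "dt Om \<equiv> time_deriv (L2 Om) (L2norm Om)"

definition strongly_measurable_time ::
  "real \<Rightarrow> (real^3 \<Rightarrow> 'b::euclidean_space) set \<Rightarrow> ((real^3 \<Rightarrow> 'b) \<Rightarrow> real) \<Rightarrow>
   (real \<Rightarrow> real^3 \<Rightarrow> 'b) \<Rightarrow> bool" where
  "strongly_measurable_time T X N u \<longleftrightarrow>
     (\<exists>s. (\<forall>n. simple_function (lebesgue_on {0<..<T}) (s n) \<and> (\<forall>t\<in>{0<..<T}. s n t \<in> X)) \<and>
        (AE t in lebesgue_on {0<..<T}. (\<lambda>n::nat. N (\<lambda>x. s n t x - u t x)) \<longlonglongrightarrow> 0))"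

definition L2_time ::
  "real \<Rightarrow> (real^3 \<Rightarrow> 'b::euclidean_space) set \<Rightarrow> ((real^3 \<Rightarrow> 'b) \<Rightarrow> real) \<Rightarrow>
   (real \<Rightarrow> real^3 \<Rightarrow> 'b) set" where
  "L2_time T X N = {u. (\<forall>t\<in>{0<..<T}. u t \<in> X) \<and> strongly_measurable_time T X N u \<and>
     integrable (lebesgue_on {0<..<T}) (\<lambda>t. (N (u t))\<^sup>2)}"

definition initial_value ::
  "(real^3) set \<Rightarrow> (real \<Rightarrow> real^3 \<Rightarrow> real^3) \<Rightarrow> (real^3 \<Rightarrow> real^3) \<Rightarrow> bool" where
  "initial_value Om u u0 \<longleftrightarrow> u0 \<in> L2 Om \<and>
     ((\<lambda>t. L2norm Om (\<lambda>x. u t x - u0 x)) \<longlongrightarrow> 0) (at_right 0)"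

definition permittivity ::
  "real \<Rightarrow> (real^3 \<Rightarrow> real) \<Rightarrow> (real^3 \<Rightarrow> real) \<Rightarrow> (real^3 \<Rightarrow> real^3) \<Rightarrow> real^3 \<Rightarrow> real^3^3" where
  "permittivity eps0 chi1 chi3 E x = eps0 *\<^sub>R
     ((1 + chi1 x + chi3 x * (norm (E x))\<^sup>2) *\<^sub>R mat 1 +
      (2 * chi3 x) *\<^sub>R ((columnvector (E x) :: real^1^3) ** (rowvector (E x) :: real^3^1)))"

definition psd_matrix :: "real^3^3 \<Rightarrow> bool" where
  "psd_matrix A \<longleftrightarrow> transpose A = A \<and> (\<forall>v. v \<bullet> (A *v v) \<ge> 0)"

definition mat_sqrt :: "real^3^3 \<Rightarrow> real^3^3" where
  "mat_sqrt A = (SOME B. psd_matrix B \<and> B ** B = A)"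

definition C1_time_matrix_weight ::
  "real \<Rightarrow> (real^3) set \<Rightarrow> (real \<Rightarrow> real^3 \<Rightarrow> real^3^3) \<Rightarrow> (real \<Rightarrow> real^3 \<Rightarrow> real^3) set" where
  "C1_time_matrix_weight T Om M = {u \<in> C1_time T (L2 Om) (L2norm Om).
     (\<lambda>t x. mat_sqrt (M t x) *v u t x) \<in> C0_time T (L2 Om) (L2norm Om) \<and>
     (\<lambda>t x. mat_sqrt (M t x) *v dt Om u t x) \<in> C0_time T (L2 Om) (L2norm Om)}"

(* The pairings of eps(E) dt E and of Je with an arbitrary L2 test field are not automatically
   convergent, so the first equation asserts their convergence; all other pairings are between
   L2 fields. *)
definition weak_solution ::
  "(real^3) set \<Rightarrow> real \<Rightarrow> real \<Rightarrow> real \<Rightarrow> (real^3 \<Rightarrow> real) \<Rightarrow> (real^3 \<Rightarrow> real) \<Rightarrow>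
   (real \<Rightarrow> real^3 \<Rightarrow> real^3) \<Rightarrow> (real \<Rightarrow> real^3 \<Rightarrow> real^3) \<Rightarrow>
   (real^3 \<Rightarrow> real^3) \<Rightarrow> (real^3 \<Rightarrow> real^3) \<Rightarrow>
   (real \<Rightarrow> real^3 \<Rightarrow> real^3) \<Rightarrow> (real \<Rightarrow> real^3 \<Rightarrow> real^3) \<Rightarrow> bool" where
  "weak_solution Om T eps0 mu0 chi1 chi3 Je Jm E0 H0 E H \<longleftrightarrow>
     E \<in> C1_time_matrix_weight T Om (\<lambda>t. permittivity eps0 chi1 chi3 (E t)) \<inter>
         C0_time T (H0curl Om) (Hcurl_norm Om) \<and>
     H \<in> C1_time T (L2 Om) (L2norm Om) \<inter> C0_time T (Hcurl Om) (Hcurl_norm Om) \<and>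
     (\<forall>t\<in>{0<..<T}. \<forall>\<Psi>\<in>L2 Om.
        pairing_defined Om (\<lambda>x. permittivity eps0 chi1 chi3 (E t) x *v dt Om E t x) \<Psi> \<and>
        pairing_defined Om (Je t) \<Psi> \<and>
        pairing Om (\<lambda>x. permittivity eps0 chi1 chi3 (E t) x *v dt Om E t x) \<Psi>
          - pairing Om (weak_curl Om (H t)) \<Psi> = - pairing Om (Je t) \<Psi>) \<and>
     (\<forall>t\<in>{0<..<T}. \<forall>\<Phi>\<in>Hcurl Om.
        pairing Om (\<lambda>x. mu0 *\<^sub>R dt Om H t x) \<Phi> + pairing Om (E t) (weak_curl Om \<Phi>)
          = - pairing Om (Jm t) \<Phi>) \<and>
     initial_value Om E E0 \<and> initial_value Om H H0"

definition energy ::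
  "(real^3) set \<Rightarrow> real \<Rightarrow> real \<Rightarrow> (real^3 \<Rightarrow> real) \<Rightarrow> (real^3 \<Rightarrow> real) \<Rightarrow>
   (real \<Rightarrow> real^3 \<Rightarrow> real^3) \<Rightarrow> (real \<Rightarrow> real^3 \<Rightarrow> real^3) \<Rightarrow> real \<Rightarrow> real" where
  "energy Om eps0 mu0 chi1 chi3 E H t = 1/2 *
     ((wnorm Om (\<lambda>x. eps0 * (1 + chi1 x)) (E t))\<^sup>2
      + 3/2 * (wnorm Om (\<lambda>x. eps0 * chi3 x) (\<lambda>x. (norm (E t x))\<^sup>2))\<^sup>2
      + (wnorm Om (\<lambda>_. mu0) (H t))\<^sup>2)"

end

theory Submission
  imports Defs
begin

text \<open>Testing with \<open>\<Psi> = E(t)\<close> and \<open>\<Phi> = H(t)\<close> and adding the equations, the curl terms cancel, so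
  what remains is \<open>W' = (\<epsilon>(E) E', E) + \<mu>\<^sub>0 (H', H)\<close>.  The magnetic part is quadratic.  The difficulty of the
  electric part is that E is differentiable in L2 only, while its energy density is quartic with
  unbounded coefficients.  Truncate the coefficients and damp the quartic term so that the density
  has a globally Lipschitz gradient; the truncated energies are then differentiable.  Put
  \<open>A = \<epsilon>(E)^(1/2) E\<close> and \<open>B = \<epsilon>(E)^(1/2) E'\<close>, so that \<open>A \<cdot> B = \<epsilon>(E) E' \<cdot> E\<close>.  The derivatives of the
  truncated energies are integrals of densities dominated by \<open>|A \<cdot> B|\<close>, hence bounded in time and
  convergent to (A, B).  Passing to the limit in the fundamental theorem of calculus, the electric energy
  is an integral of (A, B) over time, and (A, B) is continuous by the regularity assumed of the
  solution.\<close>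

section \<open>The space L2\<close>

lemma L2_iff:
  "u \<in> L2 Om \<longleftrightarrow> u \<in> borel_measurable (lebesgue_on Om) \<and>
     integrable (lebesgue_on Om) (\<lambda>x. (norm (u x))\<^sup>2)"
  by (simp add: L2w_def)

lemma L2norm_nonneg [simp]: "L2norm Om u \<ge> 0"
  by (simp add: wnorm_def)

lemma L2norm_power2: "(L2norm Om u)\<^sup>2 = (LINT x|lebesgue_on Om. (norm (u x))\<^sup>2)"
  by (simp add: wnorm_def)

lemma L2_inner_integrable:
  fixes u v :: "real^3 \<Rightarrow> 'b::euclidean_space"
  assumes "u \<in> L2 Om" "v \<in> L2 Om"
  shows "integrable (lebesgue_on Om) (\<lambda>x. u x \<bullet> v x)"
proof (rule Bochner_Integration.integrable_bound)
  show "integrable (lebesgue_on Om) (\<lambda>x. (norm (u x))\<^sup>2 + (norm (v x))\<^sup>2)"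
    using assms by (auto simp: L2_iff)
  show "(\<lambda>x. u x \<bullet> v x) \<in> borel_measurable (lebesgue_on Om)"
    using assms by (auto simp: L2_iff)
  have "norm (u x \<bullet> v x) \<le> norm ((norm (u x))\<^sup>2 + (norm (v x))\<^sup>2)" for x
  proof -
    have "\<bar>u x \<bullet> v x\<bar> \<le> norm (u x) * norm (v x)"
      by (rule Cauchy_Schwarz_ineq2)
    also have "\<dots> \<le> (norm (u x))\<^sup>2 + (norm (v x))\<^sup>2"
      using sum_squares_bound[of "norm (u x)" "norm (v x)"] mult_nonneg_nonneg[OF norm_ge_zero norm_ge_zero, of "u x" "v x"]
      by linarith
    finally show ?thesis by simp
  qed
  then show "AE x in lebesgue_on Om. norm (u x \<bullet> v x) \<le> norm ((norm (u x))\<^sup>2 + (norm (v x))\<^sup>2)"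
    by simp
qed

lemma L2_add:
  fixes u v :: "real^3 \<Rightarrow> 'b::euclidean_space"
  assumes "u \<in> L2 Om" "v \<in> L2 Om"
  shows "(\<lambda>x. u x + v x) \<in> L2 Om"
proof -
  have "(norm (u x + v x))\<^sup>2 = (norm (u x))\<^sup>2 + 2 * (u x \<bullet> v x) + (norm (v x))\<^sup>2" for x
    by (simp add: power2_norm_eq_inner inner_add_left inner_add_right inner_commute)
  then show ?thesis
    using assms L2_inner_integrable[OF assms] by (auto simp: L2_iff)
qed

lemma L2_scaleR:
  fixes u :: "real^3 \<Rightarrow> 'b::euclidean_space"
  assumes "u \<in> L2 Om"
  shows "(\<lambda>x. c *\<^sub>R u x) \<in> L2 Om"
  using assms by (auto simp: L2_iff power_mult_distrib)

lemma L2_diff: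
  fixes u v :: "real^3 \<Rightarrow> 'b::euclidean_space"
  assumes "u \<in> L2 Om" "v \<in> L2 Om"
  shows "(\<lambda>x. u x - v x) \<in> L2 Om"
  using L2_add[OF assms(1) L2_scaleR[OF assms(2), of "-1"]] by simp

lemma pairing_diff_left:
  fixes u v w :: "real^3 \<Rightarrow> 'b::euclidean_space"
  assumes "u \<in> L2 Om" "v \<in> L2 Om" "w \<in> L2 Om"
  shows "pairing Om (\<lambda>x. u x - v x) w = pairing Om u w - pairing Om v w"
  unfolding pairing_def using assms by (simp add: inner_diff_left L2_inner_integrable)

lemma pairing_commute: "pairing Om u v = pairing Om v u"
  by (simp add: pairing_def inner_commute)

text \<open>The squared seminorm of u - c v is a nonnegative quadratic in c. As
  \<open>L2norm\<close> is only a seminorm on representatives, its leading coefficient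
  \<open>q\<close> may vanish, and that case is settled separately.\<close>

lemma pairing_Cauchy_Schwarz:
  fixes u v :: "real^3 \<Rightarrow> 'b::euclidean_space"
  assumes u: "u \<in> L2 Om" and v: "v \<in> L2 Om"
  shows "\<bar>pairing Om u v\<bar> \<le> L2norm Om u * L2norm Om v"
proof -
  define p q r where "p = (L2norm Om u)\<^sup>2" and "q = (L2norm Om v)\<^sup>2" and "r = pairing Om u v"
  have *: "0 \<le> p - 2 * c * r + c\<^sup>2 * q" for c
  proof -
    have "(norm (u x - c *\<^sub>R v x))\<^sup>2
        = (norm (u x))\<^sup>2 - 2 * c * (u x \<bullet> v x) + c\<^sup>2 * (norm (v x))\<^sup>2" for x
      unfolding power2_norm_eq_inner inner_diff_left inner_diff_right
        inner_scaleR_left inner_scaleR_right inner_commute[of "v x" "u x"]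
      by (simp only: power2_eq_square) algebra
    then have "(L2norm Om (\<lambda>x. u x - c *\<^sub>R v x))\<^sup>2 = p - 2 * c * r + c\<^sup>2 * q"
      using assms L2_inner_integrable[OF assms]
      by (simp add: p_def q_def r_def L2norm_power2 L2_iff pairing_def)
    then show ?thesis by (metis zero_le_power2)
  qed
  have "r\<^sup>2 \<le> p * q"
  proof (cases "q = 0")
    case True
    have "r = 0"
    proof (rule ccontr)
      assume "r \<noteq> 0"
      \<comment> \<open>With \<open>q\<close> equal to 0 the quadratic is affine in c, and at this c
        it takes the value -1.\<close>
      then show False
        using *[of "(p + 1) / (2 * r)"] True by simp
    qed
    with True show ?thesis by simp
  next
    case False
    then have "q > 0" by (simp add: q_def)
    \<comment> \<open>The choice c = r / q minimises the quadratic.\<close>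
    with *[of "r / q"] show ?thesis
      by (simp add: power2_eq_square field_simps)
  qed
  then have "\<bar>r\<bar>\<^sup>2 \<le> (L2norm Om u * L2norm Om v)\<^sup>2"
    by (simp add: p_def q_def power_mult_distrib)
  then show ?thesis
    unfolding r_def by (rule power2_le_imp_le) simp
qed

lemma L2norm_triangle:
  fixes u v :: "real^3 \<Rightarrow> 'b::euclidean_space"
  assumes u: "u \<in> L2 Om" and v: "v \<in> L2 Om"
  shows "L2norm Om (\<lambda>x. u x + v x) \<le> L2norm Om u + L2norm Om v"
proof (rule power2_le_imp_le)
  have "(norm (u x + v x))\<^sup>2 = (norm (u x))\<^sup>2 + 2 * (u x \<bullet> v x) + (norm (v x))\<^sup>2" for x
    by (simp add: power2_norm_eq_inner inner_add_left inner_add_right inner_commute)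
  then have "(L2norm Om (\<lambda>x. u x + v x))\<^sup>2
      = (L2norm Om u)\<^sup>2 + 2 * pairing Om u v + (L2norm Om v)\<^sup>2"
    using assms L2_inner_integrable[OF assms]
    by (simp add: L2norm_power2 L2_iff pairing_def)
  then show "(L2norm Om (\<lambda>x. u x + v x))\<^sup>2 \<le> (L2norm Om u + L2norm Om v)\<^sup>2"
    using pairing_Cauchy_Schwarz[OF u v] by (simp add: power2_sum)
qed simp

text \<open>The increment splits as (u(s) - u(t), v(s)) + (u(t), v(s) - v(t)). Cauchy-Schwarz and
  the bound on \<open>v\<close> contained in \<open>C0_time\<close> make both terms vanish as s
  tends to t. Applied to \<open>A\<close> and \<open>B\<close>, this gives a limiting derivative
  that is continuous in time.\<close>

lemma continuous_on_pairing:
  fixes u v :: "real \<Rightarrow> real^3 \<Rightarrow> 'b::euclidean_space"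
  assumes u: "u \<in> C0_time T (L2 Om) (L2norm Om)" and v: "v \<in> C0_time T (L2 Om) (L2norm Om)"
  shows "continuous_on {0<..<T} (\<lambda>t. pairing Om (u t) (v t))"
  unfolding continuous_on_eq_continuous_at[OF open_greaterThanLessThan]
proof
  fix t assume t: "t \<in> {0<..<T}"
  obtain K where K: "\<And>s. s \<in> {0<..<T} \<Longrightarrow> L2norm Om (v s) \<le> K"
    using v unfolding C0_time_def bounded_iff by (force simp: abs_of_nonneg)
  have uL: "u s \<in> L2 Om" and vL: "v s \<in> L2 Om" if "s \<in> {0<..<T}" for s
    using u v that by (auto simp: C0_time_def)
  have lu: "((\<lambda>s. L2norm Om (\<lambda>x. u s x - u t x)) \<longlongrightarrow> 0) (at t)"
    and lv: "((\<lambda>s. L2norm Om (\<lambda>x. v s x - v t x)) \<longlongrightarrow> 0) (at t)"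
    using u v t by (auto simp: C0_time_def)
  have "((\<lambda>s. L2norm Om (\<lambda>x. u s x - u t x) * K + L2norm Om (u t) * L2norm Om (\<lambda>x. v s x - v t x))
      \<longlongrightarrow> 0 * K + L2norm Om (u t) * 0) (at t)"
    by (intro tendsto_intros lu lv)
  then have lim: "((\<lambda>s. L2norm Om (\<lambda>x. u s x - u t x) * K + L2norm Om (u t) * L2norm Om (\<lambda>x. v s x - v t x))
      \<longlongrightarrow> 0) (at t)" by simp
  have main: "\<bar>pairing Om (u s) (v s) - pairing Om (u t) (v t)\<bar>
      \<le> L2norm Om (\<lambda>x. u s x - u t x) * K + L2norm Om (u t) * L2norm Om (\<lambda>x. v s x - v t x)"
    if s: "s \<in> {0<..<T}" for s
  proof -
    have "pairing Om (u s) (v s) - pairing Om (u t) (v t)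
        = pairing Om (\<lambda>x. u s x - u t x) (v s) + pairing Om (\<lambda>x. v s x - v t x) (u t)"
      using s t by (simp add: pairing_diff_left uL vL pairing_commute[of Om "u t"])
    also have "\<bar>\<dots>\<bar> \<le> \<bar>pairing Om (\<lambda>x. u s x - u t x) (v s)\<bar> + \<bar>pairing Om (\<lambda>x. v s x - v t x) (u t)\<bar>"
      by (rule abs_triangle_ineq)
    also have "\<dots> \<le> L2norm Om (\<lambda>x. u s x - u t x) * L2norm Om (v s)
        + L2norm Om (\<lambda>x. v s x - v t x) * L2norm Om (u t)"
      using s t by (intro add_mono pairing_Cauchy_Schwarz L2_diff uL vL)
    also have "\<dots> \<le> L2norm Om (\<lambda>x. u s x - u t x) * K + L2norm Om (u t) * L2norm Om (\<lambda>x. v s x - v t x)"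
      using K[OF s] by (intro add_mono mult_left_mono) (auto simp: mult.commute)
    finally show ?thesis .
  qed
  have "eventually (\<lambda>s. s \<in> {0<..<T}) (at t)"
    using t by (intro eventually_at_in_open') auto
  then have "((\<lambda>s. pairing Om (u s) (v s) - pairing Om (u t) (v t)) \<longlongrightarrow> 0) (at t)"
    by (intro Lim_null_comparison[OF _ lim]) (auto elim!: eventually_mono intro: main)
  then show "isCont (\<lambda>t. pairing Om (u t) (v t)) t"
    by (simp add: isCont_def LIM_zero_iff)
qed

lemma C1_time_has_time_deriv:
  assumes "u \<in> C1_time T X N" "t \<in> {0<..<T}"
  shows "has_time_deriv X N u (time_deriv X N u t) t"
proof -
  have "\<exists>v. has_time_deriv X N u v t"
    using assms by (simp add: C1_time_def)
  then show ?thesis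
    unfolding time_deriv_def by (rule someI_ex)
qed

section \<open>Differentiation under limits and integrals\<close>

text \<open>The derivatives converge only pointwise and boundedly, so the limit is taken in
  integrated form: the fundamental theorem of calculus for each \<open>W n\<close>, dominated
  convergence with the constant \<open>K\<close>, then differentiation of the integral of the
  continuous \<open>d\<close>.\<close>

lemma has_real_derivative_limit:
  fixes W D :: "nat \<Rightarrow> real \<Rightarrow> real"
  assumes der: "\<And>n s. s \<in> {a<..<b} \<Longrightarrow> (W n has_real_derivative D n s) (at s)"
    and bound: "\<And>n s. s \<in> {a<..<b} \<Longrightarrow> \<bar>D n s\<bar> \<le> K"
    and limD: "\<And>s. s \<in> {a<..<b} \<Longrightarrow> (\<lambda>n. D n s) \<longlonglongrightarrow> d s"
    and limW: "\<And>s. s \<in> {a<..<b} \<Longrightarrow> (\<lambda>n. W n s) \<longlonglongrightarrow> w s"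
    and cont: "continuous_on {a<..<b} d"
    and t: "t \<in> {a<..<b}"
  shows "(w has_real_derivative d t) (at t)"
proof -
  \<comment> \<open>Nothing is assumed at the endpoints a and b, so integration starts at an
    interior base point c, with t interior to [c, e].\<close>
  obtain c e where ce: "a < c" "c < t" "t < e" "e < b"
    using t dense[of a t] dense[of t b] by auto
  have eq: "w s = w c + integral {c..s} d" if s: "s \<in> {c..e}" for s
  proof -
    have sub: "{c..s} \<subseteq> {a<..<b}" using s ce by auto
    have "(W n has_vector_derivative D n r) (at r within {c..s})" if "r \<in> {c..s}" for n r
      unfolding has_real_derivative_iff_has_vector_derivative[symmetric]
      by (rule has_field_derivative_at_within, rule der) (use that sub in auto)
    then have int: "(D n has_integral W n s - W n c) {c..s}" for n
      using s by (intro fundamental_theorem_of_calculus) simp_all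
    have "(\<lambda>n. integral {c..s} (D n)) \<longlonglongrightarrow> integral {c..s} d"
    proof (rule dominated_convergence(2)[where h = "\<lambda>_. K"])
      show "D n integrable_on {c..s}" for n
        using int by (rule has_integral_integrable)
      show "(\<lambda>_. K) integrable_on {c..s}"
        by (rule integrable_const_ivl)
      show "norm (D n r) \<le> K" if "r \<in> {c..s}" for n r
        using bound[of r n] that sub by (metis real_norm_def subsetD)
      show "(\<lambda>n. D n r) \<longlonglongrightarrow> d r" if "r \<in> {c..s}" for r
        using limD[of r] that sub by (metis subsetD)
    qed
    then have "(\<lambda>n. W n s - W n c) \<longlonglongrightarrow> integral {c..s} d"
      by (simp only: integral_unique[OF int])
    moreover have "(\<lambda>n. W n s - W n c) \<longlonglongrightarrow> w s - w c"
      using s ce by (intro tendsto_diff limW) auto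
    ultimately have "integral {c..s} d = w s - w c"
      by (rule LIMSEQ_unique)
    then show ?thesis by simp
  qed
  have "continuous_on {c..e} d"
    using cont by (rule continuous_on_subset) (use ce in auto)
  then have "((\<lambda>s. integral {c..s} d) has_real_derivative d t) (at t within {c..e})"
    by (rule integral_has_real_derivative) (use ce in auto)
  then have "((\<lambda>s. integral {c..s} d) has_real_derivative d t) (at t)"
    using ce by (simp add: at_within_Icc_at)
  from DERIV_add[OF DERIV_const[of "w c"] this]
  have "((\<lambda>s. w c + integral {c..s} d) has_real_derivative d t) (at t)"
    by simp
  then show ?thesis
  proof (rule has_field_derivative_transform_within_open[where S = "{c<..<e}"])
    show "w c + integral {c..s} d = w s" if "s \<in> {c<..<e}" for s
      by (rule eq[symmetric]) (use that in auto)
  qed (use ce in auto)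
qed

text \<open>A chain rule along curves differentiable in L2 only, where a time derivative at fixed x
  need not exist. Since \<open>K\<close> is the same for almost all x, the remainder integrates to a
  multiple of the squared L2 norm of the increment, which is of second order in s - t.
  \<open>g\<close> acts as the pointwise gradient of \<open>phi\<close> at
  \<open>u t\<close>.\<close>

lemma has_real_derivative_integral_composition:
  fixes u :: "real \<Rightarrow> real^3 \<Rightarrow> 'b::euclidean_space"
    and phi :: "real^3 \<Rightarrow> 'b \<Rightarrow> real" and g :: "real^3 \<Rightarrow> 'b"
  assumes I: "open I" "t \<in> I" and u: "\<And>s. s \<in> I \<Longrightarrow> u s \<in> L2 Om"
    and deriv: "has_time_deriv (L2 Om) (L2norm Om) u v t"
    and phi: "\<And>s. s \<in> I \<Longrightarrow> integrable (lebesgue_on Om) (\<lambda>x. phi x (u s x))"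
    and g: "g \<in> L2 Om"
    and rem: "AE x in lebesgue_on Om. \<forall>h. \<bar>phi x (u t x + h) - phi x (u t x) - g x \<bullet> h\<bar> \<le> K * (norm h)\<^sup>2"
  shows "((\<lambda>s. LINT x|lebesgue_on Om. phi x (u s x)) has_real_derivative pairing Om g v) (at t)"
proof -
  let ?F = "\<lambda>s. LINT x|lebesgue_on Om. phi x (u s x)"
  define q where "q s x = (u s x - u t x) /\<^sub>R (s - t)" for s x
  define N where "N s = L2norm Om (\<lambda>x. q s x - v x)" for s
  have v: "v \<in> L2 Om" and N0: "(N \<longlongrightarrow> 0) (at t)"
    using deriv unfolding has_time_deriv_def N_def[abs_def] q_def by auto
  \<comment> \<open>The first term pairs the gradient with the error of the difference quotient. The
    second bounds the remainder, \<open>N s + L2norm Om v\<close> being a bound for the norm of the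
    quotient.\<close>
  have main: "\<bar>(?F s - ?F t) / (s - t) - pairing Om g v\<bar>
      \<le> L2norm Om g * N s + \<bar>s - t\<bar> * (\<bar>K\<bar> * (N s + L2norm Om v)\<^sup>2)"
    if s: "s \<in> I" "s \<noteq> t" for s
  proof -
    have q: "q s \<in> L2 Om"
      unfolding q_def using u[OF s(1)] u[OF I(2)] by (intro L2_scaleR L2_diff)
    have qv: "(\<lambda>x. q s x - v x) \<in> L2 Om"
      by (intro L2_diff q v)
    have split: "(?F s - ?F t) / (s - t) - pairing Om g v
      = pairing Om g (\<lambda>x. q s x - v x)
        + (LINT x|lebesgue_on Om. (phi x (u s x) - phi x (u t x) - g x \<bullet> (u s x - u t x)) / (s - t))"
    proof -
      have *: "(phi x (u s x) - phi x (u t x) - g x \<bullet> (u s x - u t x)) / (s - t)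
         = phi x (u s x) / (s - t) - phi x (u t x) / (s - t) - g x \<bullet> q s x" for x
        using s by (simp add: q_def diff_divide_distrib inverse_eq_divide)
      show ?thesis
        unfolding * unfolding pairing_def inner_diff_right
        using phi[OF s(1)] phi[OF I(2)] L2_inner_integrable[OF g q] L2_inner_integrable[OF g v]
        by (simp add: diff_divide_distrib)
    qed
    have "AE x in lebesgue_on Om. \<bar>(phi x (u s x) - phi x (u t x) - g x \<bullet> (u s x - u t x)) / (s - t)\<bar>
        \<le> \<bar>s - t\<bar> * \<bar>K\<bar> * (norm (q s x))\<^sup>2"
      using rem
    proof (eventually_elim)
      case (elim x)
      have "\<bar>phi x (u s x) - phi x (u t x) - g x \<bullet> (u s x - u t x)\<bar> \<le> K * (norm (u s x - u t x))\<^sup>2"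
        using elim[rule_format, of "u s x - u t x"] by simp
      also have "\<dots> \<le> \<bar>K\<bar> * (norm (u s x - u t x))\<^sup>2"
        by (intro mult_right_mono) auto
      also have "\<bar>K\<bar> * (norm (u s x - u t x))\<^sup>2 = (\<bar>s - t\<bar> * \<bar>K\<bar> * (norm (q s x))\<^sup>2) * \<bar>s - t\<bar>"
      proof -
        have "u s x - u t x = (s - t) *\<^sub>R q s x"
          using s by (simp add: q_def)
        then show ?thesis by (simp add: power_mult_distrib power2_eq_square)
      qed
      finally show ?case
        using s by (simp add: abs_divide divide_le_eq)
    qed
    then have "\<bar>LINT x|lebesgue_on Om. (phi x (u s x) - phi x (u t x) - g x \<bullet> (u s x - u t x)) / (s - t)\<bar>
        \<le> (LINT x|lebesgue_on Om. \<bar>s - t\<bar> * \<bar>K\<bar> * (norm (q s x))\<^sup>2)"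
      using q by (intro order_trans[OF integral_abs_bound] integral_mono_AE') (auto simp: L2_iff)
    also have "\<dots> = \<bar>s - t\<bar> * (\<bar>K\<bar> * (L2norm Om (q s))\<^sup>2)"
      by (simp add: L2norm_power2)
    also have "\<dots> \<le> \<bar>s - t\<bar> * (\<bar>K\<bar> * (N s + L2norm Om v)\<^sup>2)"
    proof -
      have "(L2norm Om (q s))\<^sup>2 \<le> (N s + L2norm Om v)\<^sup>2"
        using L2norm_triangle[OF qv v] by (intro power_mono) (auto simp: N_def)
      then show ?thesis by (intro mult_left_mono) auto
    qed
    finally show ?thesis
      using pairing_Cauchy_Schwarz[OF g qv] unfolding split N_def by linarith
  qed
  have "((\<lambda>s. L2norm Om g * N s + \<bar>s - t\<bar> * (\<bar>K\<bar> * (N s + L2norm Om v)\<^sup>2)) \<longlongrightarrow>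
      L2norm Om g * 0 + \<bar>t - t\<bar> * (\<bar>K\<bar> * (0 + L2norm Om v)\<^sup>2)) (at t)"
    by (intro tendsto_intros N0)
  then have lim: "((\<lambda>s. L2norm Om g * N s + \<bar>s - t\<bar> * (\<bar>K\<bar> * (N s + L2norm Om v)\<^sup>2)) \<longlongrightarrow> 0) (at t)"
    by simp
  have "eventually (\<lambda>s. s \<in> I \<and> s \<noteq> t) (at t)"
    using I by (auto simp: eventually_at_topological)
  then have "((\<lambda>s. (?F s - ?F t) / (s - t) - pairing Om g v) \<longlongrightarrow> 0) (at t)"
    by (intro Lim_null_comparison[OF _ lim]) (auto elim!: eventually_mono intro: main)
  then show ?thesis
    by (simp add: has_field_derivative_iff LIM_zero_iff)
qed

section \<open>Damping the quartic energy\<close>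

text \<open>Half the harmonic mean of n and r: a smooth substitute for the truncation of r at
  n.\<close>

definition damped_id :: "real \<Rightarrow> real \<Rightarrow> real" where
  "damped_id n r = n * r / (n + r)"

definition damped_sq :: "real \<Rightarrow> real \<Rightarrow> real" where
  "damped_sq n r = n * (r - n * ln (1 + r / n))"

text \<open>\<^term>\<open>damped_sq n\<close> is the antiderivative of \<^term>\<open>damped_id n\<close> vanishing at 0.  It is convex,
  increases to r^2/2 as n grows, and e \<mapsto> damped_sq n (|e|^2) has a globally Lipschitz gradient, which
  e \<mapsto> |e|^4 lacks.\<close>

lemma damped_id_bounds:
  assumes "n > 0" "r \<ge> 0"
  shows "0 \<le> damped_id n r" "damped_id n r \<le> r" "damped_id n r \<le> n"
proof -
  have "n * r \<le> r * (n + r)" "n * r \<le> n * (n + r)"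
    using assms by (auto simp: algebra_simps)
  then show "0 \<le> damped_id n r" "damped_id n r \<le> r" "damped_id n r \<le> n"
    using assms by (auto simp: damped_id_def pos_divide_le_eq)
qed

text \<open>The tangent inequality reduces to ln z \<le> z - 1 at z = (n + r') / (n + r).\<close>

lemma damped_sq_convex:
  assumes "n > 0" "r \<ge> 0" "r' \<ge> 0"
  shows "damped_id n r * (r' - r) \<le> damped_sq n r' - damped_sq n r"
proof -
  have eq: "1 + x / n = (n + x) / n" for x
    using assms by (simp add: field_simps)
  have "ln (1 + r' / n) - ln (1 + r / n) = ln ((n + r') / (n + r))"
    using assms unfolding eq by (simp add: ln_div)
  also have "\<dots> \<le> (n + r') / (n + r) - 1"
    using assms by (intro ln_le_minus_one) auto
  also have "\<dots> = (r' - r) / (n + r)"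
    using assms by (simp add: field_simps)
  finally have "n * n * (ln (1 + r' / n) - ln (1 + r / n)) \<le> n * n * ((r' - r) / (n + r))"
    by (rule mult_left_mono) simp
  moreover have "damped_id n r * d = n * d - n * n * (d / (n + r))" for d
    using assms by (simp add: damped_id_def field_simps)
  moreover have "damped_sq n r' - damped_sq n r
      = n * (r' - r) - n * n * (ln (1 + r' / n) - ln (1 + r / n))"
    by (simp add: damped_sq_def algebra_simps)
  ultimately show ?thesis
    by (metis diff_left_mono)
qed

text \<open>These are the tangent at 0, where value and slope vanish, and the tangent at r evaluated
  at 0. The bound linear in r yields integrability for L2 fields at fixed n; the quadratic one is
  uniform in n.\<close>

lemma damped_sq_bounds:
  assumes "n > 0" "r \<ge> 0"
  shows "0 \<le> damped_sq n r" "damped_sq n r \<le> n * r" "damped_sq n r \<le> r\<^sup>2"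
proof -
  have 0: "damped_id n 0 = 0" "damped_sq n 0 = 0"
    by (simp_all add: damped_id_def damped_sq_def)
  show "0 \<le> damped_sq n r"
    using damped_sq_convex[of n 0 r] assms by (simp add: 0)
  have "damped_sq n r \<le> damped_id n r * r"
    using damped_sq_convex[of n r 0] assms by (simp add: 0)
  moreover have "damped_id n r * r \<le> n * r" "damped_id n r * r \<le> r * r"
    using assms by (auto intro!: mult_right_mono damped_id_bounds)
  ultimately show "damped_sq n r \<le> n * r" "damped_sq n r \<le> r\<^sup>2"
    by (auto simp: power2_eq_square)
qed

text \<open>Convexity traps the error \<open>R\<close> of the first-order expansion in r between 0
  and the product of the increments of \<open>damped_id n\<close> and of r, which is quadratic in h
  uniformly in e. The inner map from e to its squared norm contributes one more term,
  \<open>damped_id n r\<close> times the squared norm of h.\<close>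

lemma damped_sq_norm_remainder:
  fixes e h :: "'b::real_inner"
  assumes n: "n > 0"
  shows "\<bar>damped_sq n ((norm (e + h))\<^sup>2) - damped_sq n ((norm e)\<^sup>2)
           - 2 * damped_id n ((norm e)\<^sup>2) * (e \<bullet> h)\<bar> \<le> 3 * n * (norm h)\<^sup>2"
proof -
  define x y r r' where "x = norm e" and "y = norm (e + h)" and "r = x\<^sup>2" and "r' = y\<^sup>2"
  have r: "r \<ge> 0" "r' \<ge> 0" by (auto simp: r_def r'_def)
  have rr: "r' - r = 2 * (e \<bullet> h) + (norm h)\<^sup>2"
    by (simp add: r_def r'_def x_def y_def power2_norm_eq_inner inner_add_left inner_add_right inner_commute)
  have xy: "(y - x)\<^sup>2 \<le> (norm h)\<^sup>2"
  proof -
    have "\<bar>y - x\<bar> \<le> norm h"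
      unfolding x_def y_def using norm_triangle_ineq3[of "e + h" e] by simp
    then show ?thesis by (metis abs_le_square_iff abs_norm_cancel)
  qed
  have "(damped_id n r' - damped_id n r) * (r' - r) = n\<^sup>2 * (r' - r)\<^sup>2 / ((n + r) * (n + r'))"
  proof -
    have "damped_id n r' - damped_id n r = n\<^sup>2 * (r' - r) / ((n + r) * (n + r'))"
      using n r by (simp add: damped_id_def power2_eq_square field_simps)
    then show ?thesis by (simp add: power2_eq_square)
  qed
  \<comment> \<open>The denominator absorbs the growth of (y + x)^2, because n (r + r') \<le> (n +
    r) (n + r').\<close>
  also have "\<dots> \<le> 2 * n * (norm h)\<^sup>2"
  proof -
    have "(r' - r)\<^sup>2 = (y - x)\<^sup>2 * (y + x)\<^sup>2"
      unfolding r_def r'_def by algebra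
    also have "\<dots> \<le> (norm h)\<^sup>2 * (2 * (r + r'))"
    proof (rule mult_mono)
      show "(y + x)\<^sup>2 \<le> 2 * (r + r')"
        using zero_le_power2[of "y - x"] unfolding r_def r'_def power2_sum power2_diff
        by (simp add: algebra_simps)
    qed (use xy in auto)
    finally have "n\<^sup>2 * (r' - r)\<^sup>2 \<le> n\<^sup>2 * ((norm h)\<^sup>2 * (2 * (r + r')))"
      by (rule mult_left_mono) simp
    also have "\<dots> = 2 * n * (norm h)\<^sup>2 * (n * (r + r'))"
      by (simp add: power2_eq_square)
    also have "\<dots> \<le> 2 * n * (norm h)\<^sup>2 * ((n + r) * (n + r'))"
      using n r by (intro mult_left_mono) (auto simp: algebra_simps)
    finally show ?thesis
      using n r by (simp add: pos_divide_le_eq)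
  qed
  finally have up: "(damped_id n r' - damped_id n r) * (r' - r) \<le> 2 * n * (norm h)\<^sup>2" .
  \<comment> \<open>The tangent at r gives the lower bound for \<open>R\<close>, the tangent at r'
    the upper one.\<close>
  have c1: "damped_id n r * (r' - r) \<le> damped_sq n r' - damped_sq n r"
    and c2: "damped_id n r' * (r - r') \<le> damped_sq n r - damped_sq n r'"
    by (intro damped_sq_convex n r)+
  define R where "R = damped_sq n r' - damped_sq n r - damped_id n r * (r' - r)"
  have "0 \<le> R" "R \<le> 2 * n * (norm h)\<^sup>2"
    using c1 c2 up by (auto simp: R_def algebra_simps)
  moreover have "0 \<le> damped_id n r * (norm h)\<^sup>2" "damped_id n r * (norm h)\<^sup>2 \<le> n * (norm h)\<^sup>2"
    using n r by (auto intro!: mult_right_mono damped_id_bounds mult_nonneg_nonneg)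
  moreover have "damped_sq n r' - damped_sq n r - 2 * damped_id n r * (e \<bullet> h)
      = R + damped_id n r * (norm h)\<^sup>2"
    unfolding R_def rr by (simp add: algebra_simps)
  \<comment> \<open>The constant 3 n is 2 n from \<open>R\<close> plus n from the bound on
    \<open>damped_id n r\<close>.\<close>
  ultimately have "\<bar>damped_sq n r' - damped_sq n r - 2 * damped_id n r * (e \<bullet> h)\<bar> \<le> 3 * n * (norm h)\<^sup>2"
    by linarith
  then show ?thesis by (simp add: r_def r'_def x_def y_def)
qed

lemma damped_sq_has_derivative:
  assumes "n > 0" "r \<ge> 0"
  shows "(damped_sq n has_real_derivative damped_id n r) (at r)"
proof -
  have "1 + r / n > 0" using assms by (simp add: add_pos_nonneg)
  then show ?thesis
    unfolding damped_sq_def[abs_def] using assms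
    by (auto intro!: derivative_eq_intros simp: damped_id_def field_simps)
qed

text \<open>All the functions vanish at 0, so it suffices to compare derivatives on [0, r]. Freezing
  the factor n / (n + x) of \<open>damped_id n x\<close> at its smallest value n / (n + r) gives the
  lower bound.\<close>

lemma damped_sq_approx:
  assumes "n > 0" "r \<ge> 0"
  shows "n / (n + r) * (r\<^sup>2 / 2) \<le> damped_sq n r" "damped_sq n r \<le> r\<^sup>2 / 2"
proof -
  have "damped_sq n 0 - n / (n + r) * (0\<^sup>2 / 2) \<le> damped_sq n r - n / (n + r) * (r\<^sup>2 / 2)"
  proof (rule DERIV_nonneg_imp_nondecreasing[OF assms(2)])
    fix x assume x: "0 \<le> x" "x \<le> r"
    have "((\<lambda>x. x\<^sup>2 / 2) has_real_derivative x) (at x)"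
      by (auto intro!: derivative_eq_intros)
    then have "((\<lambda>x. damped_sq n x - n / (n + r) * (x\<^sup>2 / 2)) has_real_derivative
        damped_id n x - n / (n + r) * x) (at x)"
      using assms x by (intro DERIV_diff DERIV_cmult damped_sq_has_derivative)
    moreover have "n / (n + r) * x \<le> damped_id n x"
      using assms x unfolding damped_id_def times_divide_eq_left
      by (intro divide_left_mono) auto
    ultimately show "\<exists>y. ((\<lambda>x. damped_sq n x - n / (n + r) * (x\<^sup>2 / 2)) has_real_derivative y) (at x) \<and> 0 \<le> y"
      by (metis diff_ge_0_iff_ge)
  qed
  then show "n / (n + r) * (r\<^sup>2 / 2) \<le> damped_sq n r"
    by (simp add: damped_sq_def)
  have "0\<^sup>2 / 2 - damped_sq n 0 \<le> r\<^sup>2 / 2 - damped_sq n r"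
  proof (rule DERIV_nonneg_imp_nondecreasing[OF assms(2)])
    fix x assume x: "0 \<le> x" "x \<le> r"
    have "((\<lambda>x. x\<^sup>2 / 2 - damped_sq n x) has_real_derivative x - damped_id n x) (at x)"
      using assms x by (auto intro!: derivative_eq_intros damped_sq_has_derivative)
    then show "\<exists>y. ((\<lambda>x. x\<^sup>2 / 2 - damped_sq n x) has_real_derivative y) (at x) \<and> 0 \<le> y"
      using damped_id_bounds(2)[OF assms(1) x(1)] by (metis diff_ge_0_iff_ge)
  qed
  then show "damped_sq n r \<le> r\<^sup>2 / 2"
    by (simp add: damped_sq_def)
qed

text \<open>Both limits rest on n / (n + r) tending to 1: \<open>damped_id n r\<close> is r times
  this factor, and \<open>damped_sq_approx\<close> squeezes \<open>damped_sq n r\<close>. The index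
  \<open>Suc k\<close> keeps n positive.\<close>

lemma damped_limits:
  assumes "r \<ge> 0"
  shows "(\<lambda>k. damped_id (real (Suc k)) r) \<longlonglongrightarrow> r"
    and "(\<lambda>k. damped_sq (real (Suc k)) r) \<longlonglongrightarrow> r\<^sup>2 / 2"
proof -
  have "(\<lambda>k. 1 / (1 + r * inverse (real (Suc k)))) \<longlonglongrightarrow> 1 / (1 + r * 0)"
    by (intro tendsto_intros LIMSEQ_inverse_real_of_nat) simp
  moreover have "1 / (1 + r * inverse (real (Suc k))) = real (Suc k) / (real (Suc k) + r)" for k
    using assms by (simp add: field_simps)
  ultimately have lim: "(\<lambda>k. real (Suc k) / (real (Suc k) + r)) \<longlonglongrightarrow> 1"
    by simp
  show "(\<lambda>k. damped_id (real (Suc k)) r) \<longlonglongrightarrow> r"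
    using tendsto_mult_right[OF lim, of r] by (simp add: damped_id_def)
  have "(\<lambda>k. real (Suc k) / (real (Suc k) + r) * (r\<^sup>2 / 2)) \<longlonglongrightarrow> r\<^sup>2 / 2"
    using tendsto_mult_right[OF lim, of "r\<^sup>2 / 2"] by simp
  then show "(\<lambda>k. damped_sq (real (Suc k)) r) \<longlonglongrightarrow> r\<^sup>2 / 2"
  proof (rule tendsto_sandwich[rotated 2, OF _ tendsto_const])
    show "\<forall>\<^sub>F k in sequentially.
        real (Suc k) / (real (Suc k) + r) * (r\<^sup>2 / 2) \<le> damped_sq (real (Suc k)) r"
      using assms by (intro always_eventually allI damped_sq_approx) auto
    show "\<forall>\<^sub>F k in sequentially. damped_sq (real (Suc k)) r \<le> r\<^sup>2 / 2"
      using assms by (intro always_eventually allI damped_sq_approx) auto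
  qed
qed

section \<open>Truncated electric energies and the limit of their derivatives\<close>

lemma min_real_Suc_tendsto: "(\<lambda>k. min c (real (Suc k))) \<longlonglongrightarrow> c"
proof (rule tendsto_eventually)
  obtain m where m: "c < real m" using reals_Archimedean2 by blast
  have "min c (real (Suc k)) = c" if "k \<ge> m" for k
    using that m by (simp add: min_def)
  then show "\<forall>\<^sub>F k in sequentially. min c (real (Suc k)) = c"
    by (auto simp: eventually_sequentially)
qed

text \<open>\<open>A\<close> and \<open>B\<close> enter only through \<open>AA\<close>,
  \<open>AB\<close> and their continuity and boundedness in time, so matrix square roots stay out of
  the argument. \<open>AA\<close> dominates the truncated densities and \<open>AB\<close> their
  derivatives; the factor a + 3 b |E|^2 is the one by which the gradient of the density multiplies
  E.\<close>

lemma quartic_energy_has_real_derivative: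
  fixes E A B :: "real \<Rightarrow> real^3 \<Rightarrow> real^3" and a b :: "real^3 \<Rightarrow> real"
  assumes E: "E \<in> C1_time T (L2 Om) (L2norm Om)"
    and meas [measurable]: "a \<in> borel_measurable (lebesgue_on Om)" "b \<in> borel_measurable (lebesgue_on Om)"
    and nonneg: "AE x in lebesgue_on Om. 0 \<le> a x \<and> 0 \<le> b x"
    and A: "A \<in> C0_time T (L2 Om) (L2norm Om)" and B: "B \<in> C0_time T (L2 Om) (L2norm Om)"
    and AA: "\<And>t. t \<in> {0<..<T} \<Longrightarrow> AE x in lebesgue_on Om.
      (norm (A t x))\<^sup>2 = (a x + 3 * b x * (norm (E t x))\<^sup>2) * (norm (E t x))\<^sup>2"
    and AB: "\<And>t. t \<in> {0<..<T} \<Longrightarrow> AE x in lebesgue_on Om.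
      A t x \<bullet> B t x = (a x + 3 * b x * (norm (E t x))\<^sup>2) * (E t x \<bullet> dt Om E t x)"
    and t: "t \<in> {0<..<T}"
  shows "((\<lambda>t. LINT x|lebesgue_on Om. a x / 2 * (norm (E t x))\<^sup>2 + 3 / 4 * b x * ((norm (E t x))\<^sup>2)\<^sup>2)
    has_real_derivative pairing Om (A t) (B t)) (at t)"
proof -
  let ?M = "lebesgue_on Om"
  \<comment> \<open>A single n = k + 1 truncates both coefficients and damps the quartic term. The
    gradient of \<open>phi k x\<close> at \<open>E s x\<close> is \<open>c k s x\<close> times
    \<open>E s x\<close>, hence \<open>g\<close>. The factor 3/2 becomes 3/4 since
    \<open>damped_sq\<close> tends to half the square.\<close>
  define phi where "phi k x e = min (a x) (real (Suc k)) / 2 * (norm e)\<^sup>2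
      + 3 / 2 * min (b x) (real (Suc k)) * damped_sq (real (Suc k)) ((norm e)\<^sup>2)"
    for k x and e :: "real^3"
  define c where "c k s x = min (a x) (real (Suc k))
      + 3 * min (b x) (real (Suc k)) * damped_id (real (Suc k)) ((norm (E s x))\<^sup>2)" for k s x
  define g where "g k s x = c k s x *\<^sub>R E s x" for k s x
  have EL: "E s \<in> L2 Om" and AL: "A s \<in> L2 Om" and BL: "B s \<in> L2 Om" if "s \<in> {0<..<T}" for s
    using that E A B by (auto simp: C0_time_def C1_time_def)
  have Em [measurable]: "E s \<in> borel_measurable ?M" if "s \<in> {0<..<T}" for s
    using EL[OF that] by (simp add: L2_iff)
  have E': "has_time_deriv (L2 Om) (L2norm Om) E (dt Om E s) s" if "s \<in> {0<..<T}" for s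
    by (rule C1_time_has_time_deriv[OF E that])
  have vL: "dt Om E s \<in> L2 Om" if "s \<in> {0<..<T}" for s
    using E'[OF that] by (simp add: has_time_deriv_def)
  \<comment> \<open>The second bound is uniform in k and serves domination; the third, at fixed k,
    puts \<open>g k s\<close> in L2. The last two bounds on \<open>phi\<close> below divide in the
    same way.\<close>
  have c_bounds: "0 \<le> c k s x" "c k s x \<le> a x + 3 * b x * (norm (E s x))\<^sup>2"
      "c k s x \<le> real (Suc k) + 3 * real (Suc k) * real (Suc k)"
    if "0 \<le> a x \<and> 0 \<le> b x" for k s x
    using that unfolding c_def
    by (intro add_nonneg_nonneg mult_nonneg_nonneg add_mono mult_mono damped_id_bounds; simp)+
  have phi_bounds: "0 \<le> phi k x e" "phi k x e \<le> (a x + 3 * b x * (norm e)\<^sup>2) * (norm e)\<^sup>2"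
      "phi k x e \<le> (real (Suc k) + 3 / 2 * real (Suc k) * real (Suc k)) * (norm e)\<^sup>2"
    if ab: "0 \<le> a x \<and> 0 \<le> b x" for k x e
  proof -
    define n r p q where "n = real (Suc k)" and "r = (norm e)\<^sup>2"
      and "p = min (a x) n" and "q = min (b x) n"
    have n: "n > 0" and r: "r \<ge> 0"
      by (simp_all add: n_def r_def)
    have p: "0 \<le> p / 2" "p / 2 \<le> a x" "p / 2 \<le> n" and q: "0 \<le> q" "q \<le> b x" "q \<le> n"
      using ab n by (auto simp: p_def q_def min_def)
    note d = damped_sq_bounds[OF n r]
    have phi: "phi k x e = p / 2 * r + 3 / 2 * (q * damped_sq n r)"
      by (simp only: phi_def p_def q_def n_def r_def mult.assoc)
    have "q * damped_sq n r \<le> n * (n * r)" "q * damped_sq n r \<le> b x * r\<^sup>2"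
      by (rule mult_mono; use q d n ab in simp)+
    moreover have "0 \<le> q * damped_sq n r" "0 \<le> b x * r\<^sup>2"
      using q d ab by simp_all
    moreover have "0 \<le> p / 2 * r" "p / 2 * r \<le> a x * r" "p / 2 * r \<le> n * r"
      using p r by (simp_all only: mult_nonneg_nonneg mult_right_mono)
    ultimately have "0 \<le> phi k x e" "phi k x e \<le> a x * r + 3 * (b x * r\<^sup>2)"
      "phi k x e \<le> n * r + 3 / 2 * (n * (n * r))"
      unfolding phi by linarith+
    then show "0 \<le> phi k x e" "phi k x e \<le> (a x + 3 * b x * (norm e)\<^sup>2) * (norm e)\<^sup>2"
      "phi k x e \<le> (real (Suc k) + 3 / 2 * real (Suc k) * real (Suc k)) * (norm e)\<^sup>2"
      unfolding n_def r_def by (simp_all only: distrib_right power2_eq_square mult.assoc)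
  qed
  have phi_meas [measurable]: "(\<lambda>x. phi k x (E s x)) \<in> borel_measurable ?M" if "s \<in> {0<..<T}" for k s
    using Em[OF that] unfolding phi_def damped_sq_def by measurable
  have c_meas [measurable]: "c k s \<in> borel_measurable ?M" if "s \<in> {0<..<T}" for k s
    using Em[OF that] unfolding c_def damped_id_def by measurable
  have phi_int: "integrable ?M (\<lambda>x. phi k x (E s x))" if s: "s \<in> {0<..<T}" for k s
  proof (rule Bochner_Integration.integrable_bound)
    show "integrable ?M (\<lambda>x. (real (Suc k) + 3 / 2 * real (Suc k) * real (Suc k)) * (norm (E s x))\<^sup>2)"
      using EL[OF s] by (auto simp: L2_iff)
    show "AE x in ?M. norm (phi k x (E s x))
        \<le> norm ((real (Suc k) + 3 / 2 * real (Suc k) * real (Suc k)) * (norm (E s x))\<^sup>2)"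
      using nonneg
    proof eventually_elim
      case (elim x)
      show ?case
        using phi_bounds(1)[OF elim, of k "E s x"] phi_bounds(3)[OF elim, of k "E s x"]
        unfolding real_norm_def by linarith
    qed
  qed (use s phi_meas in auto)
  have gL: "g k s \<in> L2 Om" if s: "s \<in> {0<..<T}" for k s
    unfolding L2_iff
  proof
    show "g k s \<in> borel_measurable ?M"
      using Em[OF s] c_meas[OF s] unfolding g_def by measurable
    then have m: "(\<lambda>x. (norm (g k s x))\<^sup>2) \<in> borel_measurable ?M"
      by measurable
    show "integrable ?M (\<lambda>x. (norm (g k s x))\<^sup>2)"
    proof (rule Bochner_Integration.integrable_bound[OF _ m])
      show "integrable ?M (\<lambda>x. (real (Suc k) + 3 * real (Suc k) * real (Suc k))\<^sup>2 * (norm (E s x))\<^sup>2)"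
        using EL[OF s] by (auto simp: L2_iff)
      show "AE x in ?M. norm ((norm (g k s x))\<^sup>2)
          \<le> norm ((real (Suc k) + 3 * real (Suc k) * real (Suc k))\<^sup>2 * (norm (E s x))\<^sup>2)"
        using nonneg
      proof eventually_elim
        case (elim x)
        have "(c k s x)\<^sup>2 \<le> (real (Suc k) + 3 * real (Suc k) * real (Suc k))\<^sup>2"
          by (intro power_mono c_bounds elim)
        then have "(c k s x)\<^sup>2 * (norm (E s x))\<^sup>2
            \<le> (real (Suc k) + 3 * real (Suc k) * real (Suc k))\<^sup>2 * (norm (E s x))\<^sup>2"
          by (intro mult_right_mono) auto
        then show ?case
          by (simp add: g_def power_mult_distrib del: of_nat_Suc)
      qed
    qed
  qed
  \<comment> \<open>With n = k + 1, the term in a contributes at most n. The quartic term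
    contributes 9 n^2: the bound 3 n on its coefficient times the 3 n of
    \<open>damped_sq_norm_remainder\<close>. Truncating a and b makes the constant independent of
    x.\<close>
  have rem: "AE x in ?M. \<forall>h. \<bar>phi k x (E s x + h) - phi k x (E s x) - g k s x \<bullet> h\<bar>
      \<le> (real (Suc k) + 9 * real (Suc k) * real (Suc k)) * (norm h)\<^sup>2" for k s
    using nonneg
  proof eventually_elim
    case (elim x)
    show ?case
    proof
      fix h
      let ?n = "real (Suc k)" and ?e = "E s x"
      define R where "R = damped_sq ?n ((norm (?e + h))\<^sup>2) - damped_sq ?n ((norm ?e)\<^sup>2)
           - 2 * damped_id ?n ((norm ?e)\<^sup>2) * (?e \<bullet> h)"
      have R: "\<bar>R\<bar> \<le> 3 * ?n * (norm h)\<^sup>2"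
        unfolding R_def by (rule damped_sq_norm_remainder) simp
      have sq: "(norm (?e + h))\<^sup>2 - (norm ?e)\<^sup>2 = 2 * (?e \<bullet> h) + (norm h)\<^sup>2"
        by (simp add: power2_norm_eq_inner inner_add_left inner_add_right inner_commute)
      have "phi k x (?e + h) - phi k x ?e - g k s x \<bullet> h
          = min (a x) ?n / 2 * ((norm (?e + h))\<^sup>2 - (norm ?e)\<^sup>2 - 2 * (?e \<bullet> h)) + 3 / 2 * min (b x) ?n * R"
        unfolding phi_def g_def c_def R_def inner_scaleR_left by (simp add: field_simps del: of_nat_Suc)
      also have "\<dots> = min (a x) ?n / 2 * (norm h)\<^sup>2 + 3 / 2 * min (b x) ?n * R"
        unfolding sq by simp
      finally have eq: "phi k x (?e + h) - phi k x ?e - g k s x \<bullet> h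
          = min (a x) ?n / 2 * (norm h)\<^sup>2 + 3 / 2 * min (b x) ?n * R" .
      have "\<bar>min (a x) ?n / 2 * (norm h)\<^sup>2\<bar> \<le> ?n * (norm h)\<^sup>2"
        using elim unfolding abs_mult by (intro mult_mono) auto
      moreover have "\<bar>3 / 2 * min (b x) ?n * R\<bar> \<le> 3 * ?n * (3 * ?n * (norm h)\<^sup>2)"
        using elim R unfolding abs_mult by (intro mult_mono) auto
      ultimately have "\<bar>phi k x (?e + h) - phi k x ?e - g k s x \<bullet> h\<bar>
          \<le> ?n * (norm h)\<^sup>2 + 3 * ?n * (3 * ?n * (norm h)\<^sup>2)"
        unfolding eq by linarith
      then show "\<bar>phi k x (?e + h) - phi k x ?e - g k s x \<bullet> h\<bar> \<le> (?n + 9 * ?n * ?n) * (norm h)\<^sup>2"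
        by (simp add: distrib_right mult.assoc del: of_nat_Suc)
    qed
  qed
  \<comment> \<open>Since c lies between 0 and the full factor a + 3 b |E|^2, truncation can only
    shrink the density of the derivative. This is the domination that replaces differentiability of
    the quartic term.\<close>
  have gv: "AE x in ?M. norm (g k s x \<bullet> dt Om E s x) \<le> \<bar>A s x \<bullet> B s x\<bar>" if s: "s \<in> {0<..<T}" for k s
    using nonneg AB[OF s]
  proof eventually_elim
    case (elim x)
    have "norm (g k s x \<bullet> dt Om E s x) = c k s x * \<bar>E s x \<bullet> dt Om E s x\<bar>"
      using c_bounds(1)[OF elim(1)] by (simp add: g_def abs_mult)
    also have "\<dots> \<le> (a x + 3 * b x * (norm (E s x))\<^sup>2) * \<bar>E s x \<bullet> dt Om E s x\<bar>"
      by (intro mult_right_mono c_bounds elim) simp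
    also have "\<dots> = \<bar>A s x \<bullet> B s x\<bar>"
      using elim by (simp add: abs_mult)
    finally show ?case .
  qed
  obtain KA where KA: "\<And>s. s \<in> {0<..<T} \<Longrightarrow> L2norm Om (A s) \<le> KA"
    using A unfolding C0_time_def bounded_iff by (force simp: abs_of_nonneg)
  obtain KB where KB: "\<And>s. s \<in> {0<..<T} \<Longrightarrow> L2norm Om (B s) \<le> KB"
    using B unfolding C0_time_def bounded_iff by (force simp: abs_of_nonneg)
  have AB_int: "integrable ?M (\<lambda>x. A s x \<bullet> B s x)" if "s \<in> {0<..<T}" for s
    using that by (intro L2_inner_integrable AL BL)
  show ?thesis
  proof (rule has_real_derivative_limit[OF _ _ _ _ continuous_on_pairing[OF A B] t])
    fix k s assume s: "s \<in> {0<..<T}"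
    show "((\<lambda>s. LINT x|?M. phi k x (E s x)) has_real_derivative pairing Om (g k s) (dt Om E s)) (at s)"
      using s rem by (intro has_real_derivative_integral_composition[where I = "{0<..<T}"] EL E' phi_int gL) auto
    \<comment> \<open>Young's inequality turns the pointwise domination into a bound on the
      derivatives uniform in k and s.\<close>
    have "\<bar>pairing Om (g k s) (dt Om E s)\<bar> \<le> (LINT x|?M. ((norm (A s x))\<^sup>2 + (norm (B s x))\<^sup>2) / 2)"
      unfolding pairing_def
    proof (rule order_trans[OF integral_abs_bound integral_mono_AE'])
      show "integrable ?M (\<lambda>x. ((norm (A s x))\<^sup>2 + (norm (B s x))\<^sup>2) / 2)"
        using AL[OF s] BL[OF s] by (auto simp: L2_iff)
      have "\<bar>A s x \<bullet> B s x\<bar> \<le> ((norm (A s x))\<^sup>2 + (norm (B s x))\<^sup>2) / 2" for x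
      proof (rule order_trans[OF Cauchy_Schwarz_ineq2])
        show "norm (A s x) * norm (B s x) \<le> ((norm (A s x))\<^sup>2 + (norm (B s x))\<^sup>2) / 2"
          using sum_squares_bound[of "norm (A s x)" "norm (B s x)"] by simp
      qed
      then show "AE x in ?M. \<bar>g k s x \<bullet> dt Om E s x\<bar> \<le> ((norm (A s x))\<^sup>2 + (norm (B s x))\<^sup>2) / 2"
        using gv[OF s, of k] unfolding real_norm_def by (auto elim!: eventually_mono intro: order_trans simp only:)
    qed simp
    also have "\<dots> = ((L2norm Om (A s))\<^sup>2 + (L2norm Om (B s))\<^sup>2) / 2"
      using AL[OF s] BL[OF s] by (simp add: L2norm_power2 L2_iff)
    also have "\<dots> \<le> (KA\<^sup>2 + KB\<^sup>2) / 2"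
      using KA[OF s] KB[OF s] by (intro divide_right_mono add_mono power_mono) auto
    finally show "\<bar>pairing Om (g k s) (dt Om E s)\<bar> \<le> (KA\<^sup>2 + KB\<^sup>2) / 2" .
  next
    fix s assume s: "s \<in> {0<..<T}"
    have "(\<lambda>k. LINT x|?M. g k s x \<bullet> dt Om E s x) \<longlonglongrightarrow> (LINT x|?M. A s x \<bullet> B s x)"
    proof (rule integral_dominated_convergence[where w = "\<lambda>x. \<bar>A s x \<bullet> B s x\<bar>"])
      show "AE x in ?M. (\<lambda>k. g k s x \<bullet> dt Om E s x) \<longlonglongrightarrow> A s x \<bullet> B s x"
        using AB[OF s]
      proof eventually_elim
        case (elim x)
        show ?case
          unfolding g_def c_def inner_scaleR_left elim
          by (intro tendsto_intros min_real_Suc_tendsto damped_limits) simp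
      qed
      show "(\<lambda>x. g k s x \<bullet> dt Om E s x) \<in> borel_measurable ?M" for k
        using L2_inner_integrable[OF gL[OF s] vL[OF s]] by (rule borel_measurable_integrable)
      show "(\<lambda>x. A s x \<bullet> B s x) \<in> borel_measurable ?M" "integrable ?M (\<lambda>x. \<bar>A s x \<bullet> B s x\<bar>)"
        using AB_int[OF s] by auto
      show "AE x in ?M. norm (g k s x \<bullet> dt Om E s x) \<le> \<bar>A s x \<bullet> B s x\<bar>" for k
        by (rule gv[OF s])
    qed
    then show "(\<lambda>k. pairing Om (g k s) (dt Om E s)) \<longlonglongrightarrow> pairing Om (A s) (B s)"
      by (simp add: pairing_def)
    show "(\<lambda>k. LINT x|?M. phi k x (E s x)) \<longlonglongrightarrow>
      (LINT x|?M. a x / 2 * (norm (E s x))\<^sup>2 + 3 / 4 * b x * ((norm (E s x))\<^sup>2)\<^sup>2)"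
    proof (rule integral_dominated_convergence[where w = "\<lambda>x. (norm (A s x))\<^sup>2"])
      have "(\<lambda>k. phi k x e) \<longlonglongrightarrow> a x / 2 * (norm e)\<^sup>2 + 3 / 2 * b x * (((norm e)\<^sup>2)\<^sup>2 / 2)" for x e
        unfolding phi_def by (intro tendsto_intros min_real_Suc_tendsto damped_limits) simp_all
      then show "AE x in ?M. (\<lambda>k. phi k x (E s x)) \<longlonglongrightarrow>
          a x / 2 * (norm (E s x))\<^sup>2 + 3 / 4 * b x * ((norm (E s x))\<^sup>2)\<^sup>2"
        by simp
      show "AE x in ?M. norm (phi k x (E s x)) \<le> (norm (A s x))\<^sup>2" for k
        using nonneg AA[OF s]
      proof eventually_elim
        case (elim x)
        show ?case
          using phi_bounds(1,2)[OF elim(1), of k "E s x"] elim(2) by simp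
      qed
      show "integrable ?M (\<lambda>x. (norm (A s x))\<^sup>2)"
        using AL[OF s] by (simp add: L2_iff)
      show "(\<lambda>x. a x / 2 * (norm (E s x))\<^sup>2 + 3 / 4 * b x * ((norm (E s x))\<^sup>2)\<^sup>2) \<in> borel_measurable ?M"
        using Em[OF s] by measurable
    qed (rule phi_meas[OF s])
  qed
qed

text \<open>For a quadratic density the remainder is exactly half the squared norm of h, so the
  chain rule applies directly with gradient \<open>u t\<close>.\<close>

lemma half_L2norm_power2_has_real_derivative:
  fixes u :: "real \<Rightarrow> real^3 \<Rightarrow> 'b::euclidean_space"
  assumes u: "u \<in> C1_time T (L2 Om) (L2norm Om)" and t: "t \<in> {0<..<T}"
  shows "((\<lambda>s. (LINT x|lebesgue_on Om. (norm (u s x))\<^sup>2 / 2)) has_real_derivative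
    pairing Om (u t) (time_deriv (L2 Om) (L2norm Om) u t)) (at t)"
proof (rule has_real_derivative_integral_composition[where I = "{0<..<T}" and K = 1])
  show uL: "u s \<in> L2 Om" if "s \<in> {0<..<T}" for s
    using u that by (auto simp: C1_time_def C0_time_def)
  show "u t \<in> L2 Om" by (rule uL[OF t])
  show "integrable (lebesgue_on Om) (\<lambda>x. (norm (u s x))\<^sup>2 / 2)" if "s \<in> {0<..<T}" for s
    using uL[OF that] by (simp add: L2_iff)
  have "(norm (u t x + h))\<^sup>2 / 2 - (norm (u t x))\<^sup>2 / 2 - u t x \<bullet> h = (norm h)\<^sup>2 / 2" for x h
    by (simp add: power2_norm_eq_inner inner_add_left inner_add_right inner_commute field_simps)
  then show "AE x in lebesgue_on Om. \<forall>h. \<bar>(norm (u t x + h))\<^sup>2 / 2 - (norm (u t x))\<^sup>2 / 2 - u t x \<bullet> h\<bar>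
      \<le> 1 * (norm h)\<^sup>2"
    by (simp only:) simp
qed (use t C1_time_has_time_deriv[OF u t] in auto)

section \<open>Square roots of the permittivity\<close>

lemma rank_one_mult_vec:
  "((columnvector e :: real^1^'n) ** (rowvector e :: real^'n^1)) *v v = (e \<bullet> v) *\<^sub>R (e :: real^'n)"
  by (simp add: vec_eq_iff matrix_vector_mult_def matrix_matrix_mult_def columnvector_def
      rowvector_def inner_vec_def sum_distrib_left mult_ac)

lemma identity_plus_rank_one_mult_vec:
  "(a *\<^sub>R mat 1 + b *\<^sub>R ((columnvector e :: real^1^'n) ** (rowvector e :: real^'n^1))) *v v
    = a *\<^sub>R v + (b * (e \<bullet> v)) *\<^sub>R (e :: real^'n)"
  by (simp add: matrix_vector_mult_add_rdistrib scaleR_matrix_vector_assoc[symmetric] rank_one_mult_vec)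

text \<open>The matrix acts as a on the complement of e and as a + b |e|^2 along e. A root of the
  same form p I + c e e^T must satisfy p = sqrt a and p + c |e|^2 = sqrt (a + b |e|^2).\<close>

lemma psd_square_root_identity_plus_rank_one:
  fixes e :: "real^3"
  assumes "a \<ge> 0" "b \<ge> 0"
  shows "\<exists>B. psd_matrix B \<and>
    B ** B = a *\<^sub>R mat 1 + b *\<^sub>R ((columnvector e :: real^1^3) ** (rowvector e :: real^3^1))"
proof -
  define r where "r = e \<bullet> e"
  define p where "p = sqrt a"
  define c where "c = (if e = 0 then 0 else (sqrt (a + b * r) - p) / r)"
  define B where "B = p *\<^sub>R mat 1 + c *\<^sub>R ((columnvector e :: real^1^3) ** (rowvector e :: real^3^1))"
  have r: "r \<ge> 0" by (simp add: r_def)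
  have p: "p \<ge> 0" "p * p = a" using assms by (auto simp: p_def)
  have c: "c \<ge> 0"
    using assms r by (auto simp: c_def p_def intro!: divide_nonneg_nonneg)
  have B: "B *v v = p *\<^sub>R v + (c * (e \<bullet> v)) *\<^sub>R e" for v
    unfolding B_def by (rule identity_plus_rank_one_mult_vec)
  \<comment> \<open>Squaring p + c r = s and subtracting p^2 = a leaves r times the claim, and r is
    positive for nonzero e.\<close>
  have coef: "2 * p * c + c * c * r = b" if "e \<noteq> 0"
  proof -
    define s where "s = sqrt (a + b * r)"
    have "s * s = a + b * r" using assms r by (simp add: s_def)
    moreover have "r > 0" "c * r = s - p" using that by (auto simp: c_def r_def s_def)
    ultimately have "(2 * p * c + c * c * r) * r = b * r"
      using p by algebra
    then show ?thesis using \<open>r > 0\<close> by simp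
  qed
  have "B ** B = a *\<^sub>R mat 1 + b *\<^sub>R ((columnvector e :: real^1^3) ** (rowvector e :: real^3^1))"
  proof (subst matrix_eq, intro allI)
    fix v
    have "(B ** B) *v v = (p * p) *\<^sub>R v + ((2 * p * c + c * c * r) * (e \<bullet> v)) *\<^sub>R e"
      unfolding matrix_vector_mul_assoc[symmetric] B
      by (simp add: r_def inner_add_right algebra_simps flip: scaleR_add_left)
    also have "\<dots> = a *\<^sub>R v + (b * (e \<bullet> v)) *\<^sub>R e"
      using coef p by (cases "e = 0") auto
    also have "\<dots> = (a *\<^sub>R mat 1 + b *\<^sub>R ((columnvector e :: real^1^3) ** (rowvector e :: real^3^1))) *v v"
      by (rule identity_plus_rank_one_mult_vec[symmetric])
    finally show "(B ** B) *v v = \<dots>" .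
  qed
  moreover have "psd_matrix B"
  proof -
    have "transpose B = B"
      by (auto simp: B_def transpose_def vec_eq_iff mat_def matrix_matrix_mult_def
          columnvector_def rowvector_def)
    moreover have "v \<bullet> (B *v v) \<ge> 0" for v
      unfolding B using p c
      by (auto simp: inner_add_right inner_commute[of v e] mult.assoc intro!: add_nonneg_nonneg)
    ultimately show ?thesis by (simp add: psd_matrix_def)
  qed
  ultimately show ?thesis by blast
qed

text \<open>Existence makes the chosen \<open>mat_sqrt A\<close> a genuine root; its symmetry moves
  one factor across the inner product.\<close>

lemma mat_sqrt_inner:
  assumes "\<exists>B. psd_matrix B \<and> B ** B = A"
  shows "(mat_sqrt A *v u) \<bullet> (mat_sqrt A *v v) = u \<bullet> (A *v v)"
proof -
  have "psd_matrix (mat_sqrt A) \<and> mat_sqrt A ** mat_sqrt A = A"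
    unfolding mat_sqrt_def using assms by (rule someI_ex)
  then show ?thesis
    by (metis dot_lmul_matrix matrix_vector_mul_assoc psd_matrix_def transpose_matrix_vector)
qed

lemma permittivity_mult_vec:
  "permittivity eps0 chi1 chi3 E x *v v
    = (eps0 * (1 + chi1 x + chi3 x * (norm (E x))\<^sup>2)) *\<^sub>R v + (eps0 * (2 * chi3 x) * (E x \<bullet> v)) *\<^sub>R E x"
  unfolding permittivity_def scaleR_add_right scaleR_scaleR
  by (rule identity_plus_rank_one_mult_vec)

lemma permittivity_sqrt_inner:
  assumes "eps0 \<ge> 0" "chi1 x \<ge> 0" "chi3 x \<ge> 0"
  shows "(mat_sqrt (permittivity eps0 chi1 chi3 E x) *v u) \<bullet> (mat_sqrt (permittivity eps0 chi1 chi3 E x) *v v)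
    = u \<bullet> (permittivity eps0 chi1 chi3 E x *v v)"
  unfolding permittivity_def scaleR_add_right scaleR_scaleR
  by (intro mat_sqrt_inner psd_square_root_identity_plus_rank_one) (use assms in auto)

section \<open>The energy identity\<close>

theorem theorem3p1:
  fixes Om :: "(real^3) set" and T eps0 mu0 :: real
    and chi1 chi3 :: "real^3 \<Rightarrow> real"
    and E0 H0 :: "real^3 \<Rightarrow> real^3"
    and Je Jm E H :: "real \<Rightarrow> real^3 \<Rightarrow> real^3"
  assumes domain: "smooth_simply_connected_domain Om"
    and "T > 0" and "eps0 > 0" and "mu0 > 0"
    and "chi1 \<in> borel_measurable (lebesgue_on Om)" and "chi3 \<in> borel_measurable (lebesgue_on Om)"
    and "AE x in lebesgue_on Om. chi1 x \<ge> 0" and "AE x in lebesgue_on Om. chi3 x \<ge> 0"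
    and H0_L2: "H0 \<in> L2 Om"
    and H0_div: "has_weak_div Om (\<lambda>x. mu0 *\<^sub>R H0 x) (\<lambda>_. 0)"
    and H0_normal: "\<forall>\<psi>\<in>test_functions UNIV. normal_trace Om H0 \<psi> = 0"
    and Je: "Je \<in> L2_time T (L2w Om (\<lambda>x. inverse eps0 * inverse (1 + chi1 x)))
                           (wnorm Om (\<lambda>x. inverse eps0 * inverse (1 + chi1 x)))"
    and Jm: "Jm \<in> L2_time T (L2w Om (\<lambda>_. inverse mu0)) (wnorm Om (\<lambda>_. inverse mu0))"
    and sol: "weak_solution Om T eps0 mu0 chi1 chi3 Je Jm E0 H0 E H"
  shows "\<forall>t\<in>{0<..<T}. (energy Om eps0 mu0 chi1 chi3 E H has_real_derivative
           - pairing Om (Je t) (E t) - pairing Om (Jm t) (H t)) (at t)"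
proof
  fix t assume t: "t \<in> {0<..<T}"
  let ?M = "lebesgue_on Om"
  let ?P = "\<lambda>t. permittivity eps0 chi1 chi3 (E t)"
  \<comment> \<open>In these terms the electric energy density is a/2 |E|^2 + 3/4 b |E|^4, where 3/4
    is the product of 1/2 and 3/2 in \<open>energy\<close>.\<close>
  define a where "a x = eps0 * (1 + chi1 x)" for x
  define b where "b x = eps0 * chi3 x" for x
  define A where "A t x = mat_sqrt (?P t x) *v E t x" for t x
  define B where "B t x = mat_sqrt (?P t x) *v dt Om E t x" for t x
  have meas: "a \<in> borel_measurable ?M" "b \<in> borel_measurable ?M"
    using assms(5,6) unfolding a_def b_def by measurable
  have chi: "AE x in ?M. 0 \<le> chi1 x \<and> 0 \<le> chi3 x"
    using assms(7,8) by eventually_elim simp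
  have nonneg: "AE x in ?M. 0 \<le> a x \<and> 0 \<le> b x"
    using chi by eventually_elim (use assms(3) in \<open>simp add: a_def b_def\<close>)
  have E: "E \<in> C1_time T (L2 Om) (L2norm Om)" and H: "H \<in> C1_time T (L2 Om) (L2norm Om)"
    and A: "A \<in> C0_time T (L2 Om) (L2norm Om)" and B: "B \<in> C0_time T (L2 Om) (L2norm Om)"
    using sol unfolding weak_solution_def C1_time_matrix_weight_def A_def[abs_def] B_def[abs_def] by auto
  have EL: "E s \<in> L2 Om" and AL: "A s \<in> L2 Om" and BL: "B s \<in> L2 Om" if "s \<in> {0<..<T}" for s
    using that E A B by (auto simp: C0_time_def C1_time_def)
  have Hcurl: "H t \<in> Hcurl Om"
    using sol t unfolding weak_solution_def C0_time_def by auto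
  \<comment> \<open>The 3 is 1 from the isotropic part of the permittivity plus 2 from its rank-one
    part.\<close>
  have AA: "AE x in ?M. (norm (A s x))\<^sup>2 = (a x + 3 * b x * (norm (E s x))\<^sup>2) * (norm (E s x))\<^sup>2" for s
    using chi
  proof eventually_elim
    case (elim x)
    have "(norm (A s x))\<^sup>2 = E s x \<bullet> (?P s x *v E s x)"
      unfolding A_def power2_norm_eq_inner
      by (rule permittivity_sqrt_inner) (use elim assms(3) in auto)
    also have "\<dots> = (a x + 3 * b x * (norm (E s x))\<^sup>2) * (norm (E s x))\<^sup>2"
      unfolding permittivity_mult_vec a_def b_def power2_norm_eq_inner inner_add_right inner_scaleR_right
      by algebra
    finally show ?case .
  qed
  have AB': "AE x in ?M. A s x \<bullet> B s x = (?P s x *v dt Om E s x) \<bullet> E s x" for s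
    using chi
    by eventually_elim (use assms(3) in \<open>simp add: A_def B_def permittivity_sqrt_inner inner_commute\<close>)
  have AB: "AE x in ?M. A s x \<bullet> B s x = (a x + 3 * b x * (norm (E s x))\<^sup>2) * (E s x \<bullet> dt Om E s x)" for s
    using AB'[of s]
  proof eventually_elim
    case (elim x)
    also have "(?P s x *v dt Om E s x) \<bullet> E s x
        = (a x + 3 * b x * (norm (E s x))\<^sup>2) * (E s x \<bullet> dt Om E s x)"
      unfolding permittivity_mult_vec a_def b_def power2_norm_eq_inner inner_add_left inner_scaleR_left
        inner_commute[of "dt Om E s x"]
      by algebra
    finally show ?case .
  qed
  have dE: "((\<lambda>t. LINT x|?M. a x / 2 * (norm (E t x))\<^sup>2 + 3 / 4 * b x * ((norm (E t x))\<^sup>2)\<^sup>2)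
    has_real_derivative pairing Om (A t) (B t)) (at t)"
    by (rule quartic_energy_has_real_derivative[OF E meas nonneg A B AA AB t])
  have dH: "((\<lambda>s. LINT x|?M. (norm (H s x))\<^sup>2 / 2) has_real_derivative pairing Om (H t) (dt Om H t)) (at t)"
    by (rule half_L2norm_power2_has_real_derivative[OF H t])
  have energy: "(LINT x|?M. a x / 2 * (norm (E s x))\<^sup>2 + 3 / 4 * b x * ((norm (E s x))\<^sup>2)\<^sup>2)
      + mu0 * (LINT x|?M. (norm (H s x))\<^sup>2 / 2) = energy Om eps0 mu0 chi1 chi3 E H s"
    if s: "s \<in> {0<..<T}" for s
  proof -
    have Em [measurable]: "E s \<in> borel_measurable ?M"
      using EL[OF s] by (simp add: L2_iff)
    have Ai: "integrable ?M (\<lambda>x. (norm (A s x))\<^sup>2)"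
      using AL[OF s] by (simp add: L2_iff)
    \<comment> \<open>Splitting the energy integral requires both densities to be integrable. Each
      is a nonnegative part of the expansion of |A|^2, up to a constant factor.\<close>
    have ia: "integrable ?M (\<lambda>x. a x * (norm (E s x))\<^sup>2)"
    proof (rule Bochner_Integration.integrable_bound[OF Ai])
      show "AE x in ?M. norm (a x * (norm (E s x))\<^sup>2) \<le> norm ((norm (A s x))\<^sup>2)"
        using nonneg AA[of s] by eventually_elim (simp add: distrib_right)
    qed (use meas in measurable)
    have ib: "integrable ?M (\<lambda>x. b x * ((norm (E s x))\<^sup>2)\<^sup>2)"
    proof (rule Bochner_Integration.integrable_bound[OF Ai])
      show "AE x in ?M. norm (b x * ((norm (E s x))\<^sup>2)\<^sup>2) \<le> norm ((norm (A s x))\<^sup>2)"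
        using nonneg AA[of s]
      proof eventually_elim
        case (elim x)
        have "b x * ((norm (E s x))\<^sup>2)\<^sup>2 \<le> (a x + 3 * b x * (norm (E s x))\<^sup>2) * (norm (E s x))\<^sup>2"
          using elim by (simp add: distrib_right power2_eq_square mult.assoc)
        then show ?case using elim by simp
      qed
    qed (use meas in measurable)
    have "(wnorm Om a (E s))\<^sup>2 = (LINT x|?M. a x * (norm (E s x))\<^sup>2)"
      unfolding wnorm_def
    proof (intro real_sqrt_pow2 integral_nonneg_AE)
      show "AE x in ?M. 0 \<le> a x * (norm (E s x))\<^sup>2"
        using nonneg by eventually_elim simp
    qed
    moreover have "(wnorm Om b (\<lambda>x. (norm (E s x))\<^sup>2))\<^sup>2 = (LINT x|?M. b x * ((norm (E s x))\<^sup>2)\<^sup>2)"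
      unfolding wnorm_def real_norm_def power2_abs
    proof (intro real_sqrt_pow2 integral_nonneg_AE)
      show "AE x in ?M. 0 \<le> b x * ((norm (E s x))\<^sup>2)\<^sup>2"
        using nonneg by eventually_elim simp
    qed
    moreover have "(wnorm Om (\<lambda>_. mu0) (H s))\<^sup>2 = mu0 * (LINT x|?M. (norm (H s x))\<^sup>2)"
      using assms(4) by (simp add: wnorm_def)
    ultimately show ?thesis
      unfolding energy_def a_def[abs_def, symmetric] b_def[abs_def, symmetric]
      using ia ib by (simp add: mult.assoc)
  qed
  \<comment> \<open>First equation with the test field E(t).\<close>
  have eqE: "pairing Om (A t) (B t) - pairing Om (weak_curl Om (H t)) (E t) = - pairing Om (Je t) (E t)"
  proof -
    have "pairing Om (A t) (B t) = pairing Om (\<lambda>x. ?P t x *v dt Om E t x) (E t)"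
      unfolding pairing_def
    proof (rule integral_cong_AE[OF _ _ AB'])
      show "(\<lambda>x. A t x \<bullet> B t x) \<in> borel_measurable ?M"
        by (intro borel_measurable_integrable L2_inner_integrable AL BL t)
      \<comment> \<open>Measurability of this product is read off from the convergence of the
        pairing asserted in \<open>weak_solution\<close>.\<close>
      have "pairing_defined Om (\<lambda>x. ?P t x *v dt Om E t x) (E t)"
        using sol t EL[OF t] unfolding weak_solution_def by blast
      then show "(\<lambda>x. (?P t x *v dt Om E t x) \<bullet> E t x) \<in> borel_measurable ?M"
        unfolding pairing_defined_def by (rule borel_measurable_integrable)
    qed
    then show ?thesis
      using sol t EL[OF t] unfolding weak_solution_def by auto
  qed
  \<comment> \<open>Second equation with the test field H(t), admissible because it lies in
    \<open>Hcurl Om\<close>.\<close>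
  have eqH: "mu0 * pairing Om (H t) (dt Om H t) + pairing Om (E t) (weak_curl Om (H t)) = - pairing Om (Jm t) (H t)"
  proof -
    have "pairing Om (\<lambda>x. mu0 *\<^sub>R dt Om H t x) (H t) = mu0 * pairing Om (H t) (dt Om H t)"
      by (simp add: pairing_def inner_commute)
    moreover have "pairing Om (\<lambda>x. mu0 *\<^sub>R dt Om H t x) (H t) + pairing Om (E t) (weak_curl Om (H t))
        = - pairing Om (Jm t) (H t)"
      using sol t Hcurl unfolding weak_solution_def by blast
    ultimately show ?thesis by simp
  qed
  have "((\<lambda>t. (LINT x|?M. a x / 2 * (norm (E t x))\<^sup>2 + 3 / 4 * b x * ((norm (E t x))\<^sup>2)\<^sup>2)
      + mu0 * (LINT x|?M. (norm (H t x))\<^sup>2 / 2))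
    has_real_derivative pairing Om (A t) (B t) + mu0 * pairing Om (H t) (dt Om H t)) (at t)"
    by (intro DERIV_add DERIV_cmult dE dH)
  then have "(energy Om eps0 mu0 chi1 chi3 E H
    has_real_derivative pairing Om (A t) (B t) + mu0 * pairing Om (H t) (dt Om H t)) (at t)"
    by (rule has_field_derivative_transform_within_open[where S = "{0<..<T}"]) (use t energy in auto)
  moreover have "pairing Om (A t) (B t) + mu0 * pairing Om (H t) (dt Om H t)
      = - pairing Om (Je t) (E t) - pairing Om (Jm t) (H t)"
    \<comment> \<open>The two curl terms are the same pairing with opposite signs.\<close>
    using eqE eqH pairing_commute[of Om "E t"] by simp
  ultimately show "(energy Om eps0 mu0 chi1 chi3 E H has_real_derivative
           - pairing Om (Je t) (E t) - pairing Om (Jm t) (H t)) (at t)"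
    by simp
qed

end
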